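(* There is a universal constant $C>0$ such that the following holds. Let $N,k,M_1,\dots,M_k\ge 1$ be integers with $\sum_{i=1}^k M_i=M$. Let $Q\subset\mathbb{R}^N$ be a non-empty subset of the Euclidean unit ball and let $E=E_1\times\cdots\times E_k\subset\mathbb{R}^M$, where for each $i$ the set $E_i\subset\mathbb{R}^{M_i}$ is non-empty, closed, and has permutation symmetry. Write $m:=\min_{1\le i\le k}M_i$. Let $A\in\mathbb{R}^{M\times N}$ be a random matrix with independent standard normal entries. Then for each $q\in[2,\infty]$, $$\operatorname{Var}\big(\mathcal{M}_q(A)\big)\le C\left(1+\frac12\log\left(\frac{m^{1-\frac2q}}{k}\vee 1\right)\right)^{-1},$$ where $\mathcal{M}_q(A)=\mathcal{M}_{q,Q,E}(A)$ is the $\ell^q$-margin.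
   Context: A set $F\subset\mathbb{R}^n$ has permutation symmetry if for every permutation $\pi\in S_n$ and every $x\in\mathbb{R}^n$: $(x_1,\dots,x_n)\in F$ if and only if $(x_{\pi(1)},\dots,x_{\pi(n)})\in F$. For $Q\subset\mathbb{R}^N$, $E\subset\mathbb{R}^M$ and a matrix $A\in\mathbb{R}^{M\times N}$, the $\ell^q$-margin is $$\mathcal{M}_q(A):=\mathcal{M}_{q,Q,E}(A):=\min_{\sigma\in Q} d_{\ell^q}(A\sigma,E),\qquad d_{\ell^q}(x,E)=\inf_{y\in E}\|x-y\|_q,$$ where the minimum over $Q$ is understood as an infimum if it is not attained. Conventions: $a\vee b=\max(a,b)$, and $1/q=2/q=0$ interpretations apply when $q=\infty$ (i.e. $2/q=0$). *)

theory Defs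
  imports "HOL-Analysis.Analysis" "HOL-Probability.Probability"
begin

text \<open>
  Since the dimensions are quantified inside the statement, the space of real \<open>n\<close>-vectors is the
  library's \<^term>\<open>topspace (Euclidean_space n)\<close>: functions of type \<^typ>\<open>nat \<Rightarrow> real\<close> vanishing at
  all indices \<open>i \<ge> n\<close>. Coordinates, and the blocks of a product, are numbered from 0.
\<close>

abbreviation Rn :: "nat \<Rightarrow> (nat \<Rightarrow> real) set" where
  "Rn n \<equiv> topspace (Euclidean_space n)"

definition permutation_symmetric :: "nat \<Rightarrow> (nat \<Rightarrow> real) set \<Rightarrow> bool" where
  "permutation_symmetric n F \<longleftrightarrow>
     (\<forall>\<pi>. \<pi> permutes {..<n} \<longrightarrow> (\<forall>x\<in>Rn n. x \<in> F \<longleftrightarrow> (\<lambda>i. x (\<pi> i)) \<in> F))"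

definition block :: "(nat \<Rightarrow> nat) \<Rightarrow> nat \<Rightarrow> (nat \<Rightarrow> real) \<Rightarrow> nat \<Rightarrow> real" where
  "block Ms i x = (\<lambda>j. if j < Ms i then x ((\<Sum>l<i. Ms l) + j) else 0)"

definition block_product :: "nat \<Rightarrow> (nat \<Rightarrow> nat) \<Rightarrow> (nat \<Rightarrow> (nat \<Rightarrow> real) set) \<Rightarrow> (nat \<Rightarrow> real) set" where
  "block_product k Ms E = {x \<in> Rn (\<Sum>i<k. Ms i). \<forall>i<k. block Ms i x \<in> E i}"

text \<open>Only used for \<open>q \<ge> 1\<close> and \<open>n \<ge> 1\<close>; for \<open>q = \<infinity>\<close> it is the maximum norm.\<close>

definition lq_norm :: "ereal \<Rightarrow> nat \<Rightarrow> (nat \<Rightarrow> real) \<Rightarrow> real" where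
  "lq_norm q n x =
     (if q = \<infinity> then Max ((\<lambda>i. \<bar>x i\<bar>) ` {..<n})
      else (\<Sum>i<n. \<bar>x i\<bar> powr real_of_ereal q) powr (1 / real_of_ereal q))"

definition lq_dist :: "ereal \<Rightarrow> nat \<Rightarrow> (nat \<Rightarrow> real) \<Rightarrow> (nat \<Rightarrow> real) set \<Rightarrow> real" where
  "lq_dist q n x E = (INF y\<in>E. lq_norm q n (\<lambda>i. x i - y i))"

definition mat_vec :: "nat \<Rightarrow> nat \<Rightarrow> (nat \<times> nat \<Rightarrow> real) \<Rightarrow> (nat \<Rightarrow> real) \<Rightarrow> nat \<Rightarrow> real" where
  "mat_vec M N A \<sigma> = (\<lambda>i. if i < M then \<Sum>j<N. A (i, j) * \<sigma> j else 0)"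

definition margin ::
  "ereal \<Rightarrow> nat \<Rightarrow> nat \<Rightarrow> (nat \<Rightarrow> real) set \<Rightarrow> (nat \<Rightarrow> real) set \<Rightarrow> (nat \<times> nat \<Rightarrow> real) \<Rightarrow> real" where
  "margin q M N Q E A = (INF \<sigma>\<in>Q. lq_dist q M (mat_vec M N A \<sigma>) E)"

text \<open>The law of an \<open>M \<times> N\<close> matrix with independent standard normal entries.\<close>

definition gaussian_matrix :: "nat \<Rightarrow> nat \<Rightarrow> (nat \<times> nat \<Rightarrow> real) measure" where
  "gaussian_matrix M N =
     PiM ({..<M} \<times> {..<N}) (\<lambda>_. density lborel (\<lambda>x. ennreal (std_normal_density x)))"

lemma prob_space_gaussian_matrix: "prob_space (gaussian_matrix M N)"
  unfolding gaussian_matrix_def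
  by (intro prob_space_PiM prob_space_normal_density) simp

end

theory Submission
  imports Defs
begin

text \<open>
  The margin \<open>F\<close> is \<open>1\<close>-Lipschitz in the Gaussian matrix \<open>A\<close>, so the Poincare inequality bounds its variance by
  a constant. The logarithmic gain is a superconcentration effect: where \<open>F\<close> is smooth, its gradient is the
  rank-one matrix \<open>w \<sigma>\<^sup>T\<close>, where \<open>\<sigma>\<close> is the minimiser in \<open>Q\<close> and \<open>w\<close> lies in the unit ball of the dual of
  \<open>\<ell>\<^sup>q\<close>. On a block of size \<open>b\<close> the vector \<open>w\<close> has \<open>\<ell>\<^sup>1\<close> norm at most \<open>b\<^sup>1\<^sup>/\<^sup>q\<close>, and since the law of \<open>A\<close> and
  the function \<open>F\<close> are invariant under permutations of the rows of a block, this mass is spread evenly over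
  the rows on average. Hence the sum of the squares of the expected absolute partial derivatives is at most
  the sum of \<open>b\<^sup>2\<^sup>/\<^sup>q\<^sup>-\<^sup>1\<close> over the blocks, that is, at most \<open>k m\<^sup>2\<^sup>/\<^sup>q\<^sup>-\<^sup>1\<close>, while the expected squared
  gradient stays bounded. A variance inequality of Talagrand type turns this into the claim.

  The inequality is used in the form of Falik and Samorodnitsky on the discrete cube
  (\<open>cube_variance_bound\<close>), where it follows by induction on the dimension from an elementary log-Sobolev
  inequality. Each Gaussian entry is approximated by a normalised sum of \<open>n\<close> random signs; the central limit
  theorem, Skorohod's theorem and Fatou's lemma show that an eventual bound for the variances on the cube
  carries over to the Gaussian matrix (\<open>gaussian_variance_le_cube_variance\<close>). On the cube, derivatives are
  differences, and the missing differentiability of \<open>F\<close> is handled by a Moreau envelope, which is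
  uniformly close to \<open>F\<close> and semiconcave: near-minimisers provide one-sided estimates for its increments
  (\<open>smooth_margin_supergradient\<close>), and these suffice because every edge of the cube has a lower end. The
  resulting estimates of energy and influences are combined in \<open>cube_variance_smooth_margin\<close>.
\<close>

section \<open>Averages and derivatives on the discrete cube\<close>

text \<open>
  A point of the discrete cube \<open>{-1, 1}\<^sup>J\<close> is coded by the subset \<open>S \<subseteq> J\<close> of its positive coordinates, so
  that functions on the cube are set functions and one more coordinate means one more element of \<open>J\<close>.
\<close>

definition cube_avg :: "'i set \<Rightarrow> ('i set \<Rightarrow> real) \<Rightarrow> real" where
  "cube_avg J f = (\<Sum>S\<in>Pow J. f S) / 2 ^ card J"

definition cube_variance :: "'i set \<Rightarrow> ('i set \<Rightarrow> real) \<Rightarrow> real" where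
  "cube_variance J f = cube_avg J (\<lambda>S. (f S)\<^sup>2) - (cube_avg J f)\<^sup>2"

definition cube_deriv :: "'i \<Rightarrow> ('i set \<Rightarrow> real) \<Rightarrow> 'i set \<Rightarrow> real" where
  "cube_deriv i f S = (f (insert i S) - f (S - {i})) / 2"

definition cube_energy :: "'i set \<Rightarrow> ('i set \<Rightarrow> real) \<Rightarrow> real" where
  "cube_energy J f = (\<Sum>i\<in>J. cube_avg J (\<lambda>S. (cube_deriv i f S)\<^sup>2))"

lemma cube_avg_empty [simp]: "cube_avg {} f = f {}"
  by (simp add: cube_avg_def)

lemma cube_avg_insert:
  assumes "finite J" "i \<notin> J"
  shows "cube_avg (insert i J) f = cube_avg J (\<lambda>S. (f (insert i S) + f S) / 2)"
proof -
  have inj: "inj_on (insert i) (Pow J)"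
    using assms by (auto simp: inj_on_def)
  have "(\<Sum>S\<in>Pow (insert i J). f S) = (\<Sum>S\<in>Pow J. f S) + (\<Sum>S\<in>Pow J. f (insert i S))"
    unfolding Pow_insert using assms
    by (subst sum.union_disjoint) (auto simp: sum.reindex[OF inj])
  then show ?thesis
    using assms unfolding cube_avg_def
    by (simp add: sum.distrib sum_divide_distrib[symmetric] add.commute)
qed

lemma cube_avg_cong:
  "(\<And>S. S \<subseteq> J \<Longrightarrow> f S = g S) \<Longrightarrow> cube_avg J f = cube_avg J g"
  unfolding cube_avg_def by (intro arg_cong2[where f="(/)"] sum.cong) auto

lemma cube_avg_mono:
  "(\<And>S. S \<subseteq> J \<Longrightarrow> f S \<le> g S) \<Longrightarrow> cube_avg J f \<le> cube_avg J g"
  unfolding cube_avg_def by (intro divide_right_mono sum_mono) auto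

lemma cube_avg_add: "cube_avg J (\<lambda>S. f S + g S) = cube_avg J f + cube_avg J g"
  by (simp add: cube_avg_def sum.distrib add_divide_distrib)

lemma cube_avg_diff: "cube_avg J (\<lambda>S. f S - g S) = cube_avg J f - cube_avg J g"
  by (simp add: cube_avg_def sum_subtractf diff_divide_distrib)

lemma cube_avg_cmult: "cube_avg J (\<lambda>S. c * f S) = c * cube_avg J f"
  by (simp add: cube_avg_def sum_distrib_left)

lemma cube_avg_const [simp]: "finite J \<Longrightarrow> cube_avg J (\<lambda>S. c) = c"
  by (simp add: cube_avg_def card_Pow)

lemma cube_avg_divide: "cube_avg J (\<lambda>S. f S / c) = cube_avg J f / c"
  by (simp add: cube_avg_def sum_divide_distrib[symmetric] mult.commute)

lemma cube_avg_sum: "cube_avg J (\<lambda>S. \<Sum>a\<in>A. f a S) = (\<Sum>a\<in>A. cube_avg J (f a))"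
  unfolding cube_avg_def by (subst sum.swap) (simp add: sum_divide_distrib)

lemma cube_avg_nonneg: "(\<And>S. S \<subseteq> J \<Longrightarrow> 0 \<le> f S) \<Longrightarrow> 0 \<le> cube_avg J f"
  unfolding cube_avg_def by (intro divide_nonneg_nonneg sum_nonneg) auto

lemma cube_avg_Cauchy_Schwarz:
  assumes "finite J"
  shows "(cube_avg J (\<lambda>S. f S * g S))\<^sup>2 \<le> cube_avg J (\<lambda>S. (f S)\<^sup>2) * cube_avg J (\<lambda>S. (g S)\<^sup>2)"
  using Cauchy_Schwarz_ineq_sum[of f g "Pow J"] unfolding cube_avg_def
  by (simp add: power_divide field_simps power2_eq_square)

lemma cube_avg_square_le:
  assumes "finite J"
  shows "(cube_avg J f)\<^sup>2 \<le> cube_avg J (\<lambda>S. (f S)\<^sup>2)"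
  using cube_avg_Cauchy_Schwarz[OF assms, of f "\<lambda>_. 1"] assms by simp

lemma cube_avg_insert_split:
  assumes "finite J" "i \<notin> J"
  shows "cube_avg (insert i J) f = (cube_avg J (\<lambda>S. f (insert i S)) + cube_avg J f) / 2"
  unfolding cube_avg_insert[OF assms] cube_avg_divide cube_avg_add ..

lemma cube_avg_reindex:
  assumes "bij_betw \<theta> (Pow J) (Pow J)"
  shows "cube_avg J (\<lambda>S. f (\<theta> S)) = cube_avg J f"
  unfolding cube_avg_def using sum.reindex_bij_betw[OF assms, of f] by simp

lemma sqrt_cube_avg_triangle:
  assumes "finite J"
  shows "(sqrt (cube_avg J (\<lambda>S. (f S)\<^sup>2)) - sqrt (cube_avg J (\<lambda>S. (g S)\<^sup>2)))\<^sup>2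
    \<le> cube_avg J (\<lambda>S. (f S - g S)\<^sup>2)"
proof -
  let ?a = "cube_avg J (\<lambda>S. (f S)\<^sup>2)" and ?b = "cube_avg J (\<lambda>S. (g S)\<^sup>2)"
  have nn: "0 \<le> ?a" "0 \<le> ?b" by (auto intro: cube_avg_nonneg)
  have "cube_avg J (\<lambda>S. f S * g S) \<le> sqrt (?a * ?b)"
    using cube_avg_Cauchy_Schwarz[OF assms, of f g] by (rule real_le_rsqrt)
  moreover have "cube_avg J (\<lambda>S. (f S - g S)\<^sup>2) = ?a + ?b - 2 * cube_avg J (\<lambda>S. f S * g S)"
    by (simp add: power2_diff cube_avg_diff cube_avg_add mult.assoc cube_avg_cmult)
  ultimately show ?thesis
    using nn by (simp add: power2_diff real_sqrt_mult)
qed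

lemma cube_avg_square_diff:
  assumes "finite J"
  shows "cube_avg J (\<lambda>S. (f S - c)\<^sup>2) = cube_variance J f + (cube_avg J f - c)\<^sup>2"
proof -
  have "(f S - c)\<^sup>2 = (f S)\<^sup>2 + c\<^sup>2 - (2 * c) * f S" for S
    by (simp add: power2_eq_square algebra_simps)
  then have "cube_avg J (\<lambda>S. (f S - c)\<^sup>2) = cube_avg J (\<lambda>S. (f S)\<^sup>2) + c\<^sup>2 - 2 * c * cube_avg J f"
    using assms by (simp only: cube_avg_diff cube_avg_add cube_avg_cmult cube_avg_const)
  then show ?thesis
    by (simp add: cube_variance_def power2_eq_square algebra_simps)
qed

lemma cube_variance_eq:
  assumes "finite J"
  shows "cube_variance J f = cube_avg J (\<lambda>S. (f S - cube_avg J f)\<^sup>2)"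
  using cube_avg_square_diff[OF assms, of f "cube_avg J f"] by simp

lemma cube_variance_le_approx:
  assumes J: "finite J" and close: "\<And>S. S \<subseteq> J \<Longrightarrow> \<bar>f S - g S\<bar> \<le> d"
  shows "cube_variance J f \<le> 2 * cube_variance J g + 2 * d\<^sup>2"
proof -
  define c where "c = cube_avg J g"
  have "cube_variance J f \<le> cube_avg J (\<lambda>S. (f S - c)\<^sup>2)"
    by (simp add: cube_avg_square_diff[OF J])
  also have "\<dots> \<le> cube_avg J (\<lambda>S. 2 * (g S - c)\<^sup>2 + 2 * d\<^sup>2)"
  proof (intro cube_avg_mono)
    fix S assume "S \<subseteq> J"
    then have "(f S - g S)\<^sup>2 \<le> d\<^sup>2" using close[of S] by (metis abs_ge_zero power2_abs power_mono)
    moreover have "(f S - c)\<^sup>2 \<le> 2 * (g S - c)\<^sup>2 + 2 * (f S - g S)\<^sup>2"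
      using zero_le_power2[of "(g S - c) - (f S - g S)"] by (simp add: power2_eq_square algebra_simps)
    ultimately show "(f S - c)\<^sup>2 \<le> 2 * (g S - c)\<^sup>2 + 2 * d\<^sup>2" by linarith
  qed
  also have "\<dots> = 2 * cube_variance J g + 2 * d\<^sup>2"
    using J by (simp add: cube_avg_add cube_avg_cmult cube_variance_eq c_def)
  finally show ?thesis .
qed

section \<open>The log-Sobolev inequality and the variance inequality on the cube\<close>

text \<open>
  The entropy is at most the variance divided by the mean, because \<open>ln x \<le> x - 1\<close>; applied to the
  values \<open>a\<^sup>2\<close> and \<open>b\<^sup>2\<close> this is a log-Sobolev inequality whose constant is twice the optimal one.
\<close>

lemma two_point_log_Sobolev:
  fixes a b :: real
  assumes "a \<ge> 0" "b \<ge> 0"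
  shows "(a\<^sup>2 * ln (a\<^sup>2) + b\<^sup>2 * ln (b\<^sup>2)) / 2
     \<le> (a\<^sup>2 + b\<^sup>2) / 2 * ln ((a\<^sup>2 + b\<^sup>2) / 2) + (a - b)\<^sup>2"
proof (cases "a = 0 \<and> b = 0")
  case True then show ?thesis by simp
next
  case False
  define m where "m = (a\<^sup>2 + b\<^sup>2) / 2"
  have m: "m > 0" using False by (auto simp: m_def sum_power2_gt_zero_iff)
  have *: "x * ln x \<le> x * ln m + x * (x / m - 1)" if "x \<ge> 0" for x :: real
  proof (cases "x = 0")
    case False
    then have x: "x > 0" using that by simp
    have "ln (x / m) \<le> x / m - 1"
      using x m by (intro ln_le_minus_one) simp
    then have "ln x \<le> ln m + (x / m - 1)"
      using x m by (simp add: ln_div)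
    then show ?thesis
      using x by (metis distrib_left mult_left_mono that)
  qed simp
  have "(a\<^sup>2 * ln (a\<^sup>2) + b\<^sup>2 * ln (b\<^sup>2)) / 2
     \<le> m * ln m + (a\<^sup>2 * (a\<^sup>2 / m - 1) + b\<^sup>2 * (b\<^sup>2 / m - 1)) / 2"
    using *[of "a\<^sup>2"] *[of "b\<^sup>2"] unfolding m_def by (simp add: field_simps)
  also have "(a\<^sup>2 * (a\<^sup>2 / m - 1) + b\<^sup>2 * (b\<^sup>2 / m - 1)) / 2 = (a\<^sup>2 * a\<^sup>2 + b\<^sup>2 * b\<^sup>2) / (2 * m) - m"
  proof -
    have "(a\<^sup>2 * (a\<^sup>2 / m - 1) + b\<^sup>2 * (b\<^sup>2 / m - 1)) / 2
      = (a\<^sup>2 * a\<^sup>2 + b\<^sup>2 * b\<^sup>2) / (2 * m) - (a\<^sup>2 + b\<^sup>2) / 2"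
      using m by (simp add: field_simps)
    then show ?thesis by (simp add: m_def)
  qed
  also have "\<dots> \<le> (a - b)\<^sup>2"
  proof -
    have "(a\<^sup>2 * a\<^sup>2 + b\<^sup>2 * b\<^sup>2) - 2 * m * m \<le> 2 * m * (a - b)\<^sup>2"
    proof -
      have "2 * m * (a - b)\<^sup>2 - ((a\<^sup>2 * a\<^sup>2 + b\<^sup>2 * b\<^sup>2) - 2 * m * m) = (a - b)\<^sup>2 * (a - b)\<^sup>2 / 2"
        unfolding m_def by (simp add: field_simps power2_eq_square)
      moreover have "(a - b)\<^sup>2 * (a - b)\<^sup>2 / 2 \<ge> 0" by simp
      ultimately show ?thesis by linarith
    qed
    then show ?thesis using m by (simp add: field_simps)
  qed
  finally show ?thesis by (simp add: m_def)
qed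

lemma cube_deriv_insert:
  assumes "i \<notin> J" "j \<in> J" "S \<subseteq> J"
  shows "cube_deriv j f (insert i S) = cube_deriv j (\<lambda>S. f (insert i S)) S"
proof -
  have "insert i S - {j} = insert i (S - {j})" using assms by auto
  then show ?thesis by (simp add: cube_deriv_def insert_commute)
qed

lemma cube_deriv_square_insert:
  assumes "finite J" "i \<notin> J"
  shows "cube_avg (insert i J) (\<lambda>S. (cube_deriv i f S)\<^sup>2) = cube_avg J (\<lambda>S. ((f (insert i S) - f S) / 2)\<^sup>2)"
proof (subst cube_avg_insert[OF assms], intro cube_avg_cong)
  fix S assume "S \<subseteq> J"
  then have "S - {i} = S" using assms by auto
  then show "((cube_deriv i f (insert i S))\<^sup>2 + (cube_deriv i f S)\<^sup>2) / 2 = ((f (insert i S) - f S) / 2)\<^sup>2"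
    by (simp add: cube_deriv_def)
qed

lemma cube_energy_insert:
  assumes "finite J" "i \<notin> J"
  shows "cube_energy (insert i J) f =
    cube_avg J (\<lambda>S. ((f (insert i S) - f S) / 2)\<^sup>2)
    + (cube_energy J (\<lambda>S. f (insert i S)) + cube_energy J f) / 2"
proof -
  have "cube_avg (insert i J) (\<lambda>S. (cube_deriv j f S)\<^sup>2) =
    (cube_avg J (\<lambda>S. (cube_deriv j (\<lambda>S. f (insert i S)) S)\<^sup>2) + cube_avg J (\<lambda>S. (cube_deriv j f S)\<^sup>2)) / 2"
    if "j \<in> J" for j
    using that assms unfolding cube_avg_insert_split[OF assms]
    by (simp add: cube_deriv_insert cong: cube_avg_cong)
  then have "(\<Sum>j\<in>J. cube_avg (insert i J) (\<lambda>S. (cube_deriv j f S)\<^sup>2))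
    = (cube_energy J (\<lambda>S. f (insert i S)) + cube_energy J f) / 2"
    by (simp only: cube_energy_def sum.distrib[symmetric] sum_divide_distrib cong: sum.cong)
  then show ?thesis
    using assms cube_deriv_square_insert[OF assms, of f]
    by (simp add: cube_energy_def)
qed

text \<open>
  Tensorisation. Splitting off one coordinate leaves the entropy of the two conditional second moments
  \<open>a\<^sup>2\<close> and \<open>b\<^sup>2\<close>. The two-point inequality bounds it by \<open>(a - b)\<^sup>2\<close>, and the reverse triangle
  inequality in \<open>L\<^sup>2\<close> bounds that by the energy in the direction that was split off.
\<close>

lemma cube_log_Sobolev:
  assumes "finite J"
  shows "cube_avg J (\<lambda>S. (h S)\<^sup>2 * ln ((h S)\<^sup>2))
    \<le> cube_avg J (\<lambda>S. (h S)\<^sup>2) * ln (cube_avg J (\<lambda>S. (h S)\<^sup>2)) + 4 * cube_energy J h"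
  using assms
proof (induction J arbitrary: h rule: finite_induct)
  case empty
  then show ?case by (simp add: cube_energy_def)
next
  case (insert i J)
  let ?h' = "\<lambda>S. h (insert i S)"
  define a where "a = sqrt (cube_avg J (\<lambda>S. (?h' S)\<^sup>2))"
  define b where "b = sqrt (cube_avg J (\<lambda>S. (h S)\<^sup>2))"
  have a: "a \<ge> 0" "a\<^sup>2 = cube_avg J (\<lambda>S. (?h' S)\<^sup>2)" and b: "b \<ge> 0" "b\<^sup>2 = cube_avg J (\<lambda>S. (h S)\<^sup>2)"
    unfolding a_def b_def by (auto intro: cube_avg_nonneg)
  have "cube_avg (insert i J) (\<lambda>S. (h S)\<^sup>2 * ln ((h S)\<^sup>2))
     = (cube_avg J (\<lambda>S. (?h' S)\<^sup>2 * ln ((?h' S)\<^sup>2)) + cube_avg J (\<lambda>S. (h S)\<^sup>2 * ln ((h S)\<^sup>2))) / 2"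
    by (rule cube_avg_insert_split[OF insert.hyps])
  also have "\<dots> \<le> (a\<^sup>2 * ln (a\<^sup>2) + b\<^sup>2 * ln (b\<^sup>2)) / 2 + 2 * (cube_energy J ?h' + cube_energy J h)"
    using insert.IH[of ?h'] insert.IH[of h] unfolding a(2) b(2) by argo
  also have "\<dots> \<le> (a\<^sup>2 + b\<^sup>2) / 2 * ln ((a\<^sup>2 + b\<^sup>2) / 2) + (a - b)\<^sup>2 + 2 * (cube_energy J ?h' + cube_energy J h)"
    using two_point_log_Sobolev[OF a(1) b(1)] by simp
  also have "(a - b)\<^sup>2 \<le> cube_avg J (\<lambda>S. (?h' S - h S)\<^sup>2)"
    unfolding a_def b_def by (rule sqrt_cube_avg_triangle[OF insert.hyps(1)])
  also have "\<dots> = 4 * cube_avg J (\<lambda>S. ((?h' S - h S) / 2)\<^sup>2)"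
    by (simp add: power_divide cube_avg_divide)
  also have "(a\<^sup>2 + b\<^sup>2) / 2 = cube_avg (insert i J) (\<lambda>S. (h S)\<^sup>2)"
    unfolding a b by (rule cube_avg_insert_split[OF insert.hyps, symmetric])
  finally show ?case
    unfolding cube_energy_insert[OF insert.hyps, of h] by (simp add: field_simps)
qed

text \<open>
  A function whose \<open>L\<^sup>1\<close> norm is much smaller than its \<open>L\<^sup>2\<close> norm has large entropy. The dependence on
  the ratio of the norms is linearised with the free parameter \<open>s\<close>, so that the bounds of different
  martingale differences can simply be added.
\<close>

lemma cube_entropy_lower_bound:
  assumes "finite J" "s > 0"
  shows "cube_avg J (\<lambda>S. (h S)\<^sup>2) * (1 + ln s) - s * (cube_avg J (\<lambda>S. \<bar>h S\<bar>))\<^sup>2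
    \<le> cube_avg J (\<lambda>S. (h S)\<^sup>2 * ln ((h S)\<^sup>2))
      - cube_avg J (\<lambda>S. (h S)\<^sup>2) * ln (cube_avg J (\<lambda>S. (h S)\<^sup>2))"
proof -
  define v where "v = cube_avg J (\<lambda>S. (h S)\<^sup>2)"
  have v0: "v \<ge> 0" unfolding v_def by (auto intro: cube_avg_nonneg)
  show ?thesis
  proof (cases "v = 0")
    case True
    have fin: "finite (Pow J)" using assms by simp
    have "(\<Sum>S\<in>Pow J. (h S)\<^sup>2) = 0" using True by (simp add: v_def cube_avg_def)
    then have "\<forall>S\<in>Pow J. (h S)\<^sup>2 = 0"
      by (subst (asm) sum_nonneg_eq_0_iff[OF fin]) auto
    then have "\<And>S. S \<subseteq> J \<Longrightarrow> h S = 0" by auto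
    then have "cube_avg J (\<lambda>S. (h S)\<^sup>2 * ln ((h S)\<^sup>2)) = 0"
      using assms by (simp cong: cube_avg_cong)
    then show ?thesis using True assms by (simp add: v_def[symmetric])
  next
    case False
    then have v: "v > 0" using v0 by simp
    define t where "t = sqrt (s * v)"
    have t: "t > 0" "t\<^sup>2 = s * v" using v assms by (auto simp: t_def)
    \<comment> \<open>The tangent line of the logarithm at \<open>t\<close>; the value of \<open>t\<close> balances the two sides.\<close>
    have pt: "x\<^sup>2 * ln (s * v) + 2 * x\<^sup>2 - 2 * t * \<bar>x\<bar> \<le> x\<^sup>2 * ln (x\<^sup>2)" for x :: real
    proof (cases "x = 0")
      case False
      then have x: "\<bar>x\<bar> > 0" by simp
      define r where "r = t / \<bar>x\<bar>"
      have "ln (t / \<bar>x\<bar>) \<le> r - 1" unfolding r_def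
        using x t by (intro ln_le_minus_one) simp
      then have "ln t + 1 - r \<le> ln \<bar>x\<bar>"
        using x t by (simp add: ln_div)
      moreover have "2 * ln \<bar>x\<bar> = ln (x\<^sup>2)"
        using x ln_realpow[of "\<bar>x\<bar>" 2] by simp
      moreover have "2 * ln t = ln (s * v)"
        using t(1) unfolding t(2)[symmetric] by (simp add: ln_realpow)
      ultimately have "ln (s * v) + 2 - 2 * r \<le> ln (x\<^sup>2)"
        by linarith
      then have "x\<^sup>2 * (ln (s * v) + 2 - 2 * r) \<le> x\<^sup>2 * ln (x\<^sup>2)"
        by (intro mult_left_mono) auto
      moreover have "x\<^sup>2 * r = t * \<bar>x\<bar>"
        unfolding r_def
        using x by (simp add: power2_eq_square field_simps flip: abs_mult)
      ultimately show ?thesis by (simp add: algebra_simps)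
    qed simp
    have "v * ln (s * v) + 2 * v - 2 * t * cube_avg J (\<lambda>S. \<bar>h S\<bar>)
        = cube_avg J (\<lambda>S. (h S)\<^sup>2 * ln (s * v) + 2 * (h S)\<^sup>2 - 2 * t * \<bar>h S\<bar>)"
      unfolding v_def
      by (simp only: cube_avg_add cube_avg_diff cube_avg_cmult mult.commute[of _ "ln _"])
    also have "\<dots> \<le> cube_avg J (\<lambda>S. (h S)\<^sup>2 * ln ((h S)\<^sup>2))"
      by (intro cube_avg_mono pt)
    finally have 1: "v * ln (s * v) + 2 * v - 2 * t * cube_avg J (\<lambda>S. \<bar>h S\<bar>)
      \<le> cube_avg J (\<lambda>S. (h S)\<^sup>2 * ln ((h S)\<^sup>2))" .
    have "2 * (sqrt v) * (sqrt s * cube_avg J (\<lambda>S. \<bar>h S\<bar>)) \<le> (sqrt v)\<^sup>2 + (sqrt s * cube_avg J (\<lambda>S. \<bar>h S\<bar>))\<^sup>2"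
      by (rule sum_squares_bound)
    then have "2 * t * cube_avg J (\<lambda>S. \<bar>h S\<bar>) \<le> v + s * (cube_avg J (\<lambda>S. \<bar>h S\<bar>))\<^sup>2"
      using v assms by (simp add: t_def real_sqrt_mult power_mult_distrib mult_ac)
    then show ?thesis
      using 1 v assms unfolding v_def[symmetric] by (simp add: ln_mult algebra_simps)
  qed
qed

text \<open>
  The inequality of Falik and Samorodnitsky. The variance of \<open>f\<close> is the sum of the second moments of
  its martingale differences, one for each coordinate; the energies of the differences add up to the
  energy of \<open>f\<close>, and the \<open>L\<^sup>1\<close> norm of the difference for \<open>i\<close> is at most the influence of \<open>i\<close> on \<open>f\<close>.
  Adding the previous two lemmas over all differences gives the claim. The induction splits off one
  coordinate as \<open>f = g \<plusminus> h\<close>, where \<open>\<plusminus> h\<close> is the last martingale difference.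
\<close>

theorem cube_variance_bound:
  assumes "finite J" "s > 0"
  shows "cube_variance J f * (1 + ln s)
    \<le> 4 * cube_energy J f + s * (\<Sum>i\<in>J. (cube_avg J (\<lambda>S. \<bar>cube_deriv i f S\<bar>))\<^sup>2)"
  using assms(1) unfolding cube_variance_def
proof (induction J arbitrary: f rule: finite_induct)
  case empty
  then show ?case by (simp add: cube_energy_def)
next
  case (insert i J)
  define g where "g S = (f (insert i S) + f S) / 2" for S
  define h where "h S = (f (insert i S) - f S) / 2" for S
  let ?A = "cube_avg (insert i J)"
  have f': "f (insert i S) = g S + h S" and f: "f S = g S - h S" for S
    by (simp_all add: g_def h_def field_simps)
  have mean: "?A f = cube_avg J g"
    using insert.hyps by (simp add: cube_avg_insert g_def[abs_def])
  have second: "?A (\<lambda>S. (f S)\<^sup>2) = cube_avg J (\<lambda>S. (g S)\<^sup>2) + cube_avg J (\<lambda>S. (h S)\<^sup>2)"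
    unfolding cube_avg_insert[OF insert.hyps] cube_avg_add[symmetric]
    by (intro cube_avg_cong) (simp add: g_def h_def field_simps power2_eq_square)
  have dg: "cube_deriv j (\<lambda>S. f (insert i S)) S = cube_deriv j g S + cube_deriv j h S"
    "cube_deriv j f S = cube_deriv j g S - cube_deriv j h S" for j S
    unfolding cube_deriv_def f' by (simp_all add: f[of "insert j S"] f[of "S - {j}"] field_simps)
  have "(cube_energy J (\<lambda>S. f (insert i S)) + cube_energy J f) / 2 = cube_energy J g + cube_energy J h"
    unfolding cube_energy_def sum_divide_distrib sum.distrib[symmetric]
    by (intro sum.cong refl, unfold cube_avg_add[symmetric] cube_avg_divide[symmetric],
        intro cube_avg_cong) (simp add: dg power2_eq_square field_simps)
  then have energy: "cube_energy (insert i J) f = cube_avg J (\<lambda>S. (h S)\<^sup>2) + cube_energy J g + cube_energy J h"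
    using cube_energy_insert[OF insert.hyps, of f] by (simp add: h_def[abs_def])
  have inf_i: "?A (\<lambda>S. \<bar>cube_deriv i f S\<bar>) = cube_avg J (\<lambda>S. \<bar>h S\<bar>)"
  proof (subst cube_avg_insert[OF insert.hyps], intro cube_avg_cong)
    fix S assume "S \<subseteq> J"
    then have "S - {i} = S" using insert.hyps by auto
    then show "(\<bar>cube_deriv i f (insert i S)\<bar> + \<bar>cube_deriv i f S\<bar>) / 2 = \<bar>h S\<bar>"
      by (simp add: cube_deriv_def h_def)
  qed
  have inf_j: "cube_avg J (\<lambda>S. \<bar>cube_deriv j g S\<bar>) \<le> ?A (\<lambda>S. \<bar>cube_deriv j f S\<bar>)" if "j \<in> J" for j
    unfolding cube_avg_insert[OF insert.hyps]
  proof (intro cube_avg_mono)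
    fix S assume S: "S \<subseteq> J"
    have "cube_deriv j f (insert i S) = cube_deriv j g S + cube_deriv j h S"
      unfolding cube_deriv_insert[OF insert.hyps(2) that S] by (rule dg)
    moreover have "cube_deriv j f S = cube_deriv j g S - cube_deriv j h S"
      by (rule dg)
    moreover have "\<bar>a\<bar> \<le> (\<bar>a + b\<bar> + \<bar>a - b\<bar>) / 2" for a b :: real
      by (simp add: abs_if)
    ultimately show "\<bar>cube_deriv j g S\<bar> \<le> (\<bar>cube_deriv j f (insert i S)\<bar> + \<bar>cube_deriv j f S\<bar>) / 2"
      by presburger
  qed
  have "(\<Sum>j\<in>J. (cube_avg J (\<lambda>S. \<bar>cube_deriv j g S\<bar>))\<^sup>2) \<le> (\<Sum>j\<in>J. (?A (\<lambda>S. \<bar>cube_deriv j f S\<bar>))\<^sup>2)"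
    by (intro sum_mono power_mono inf_j) (auto intro: cube_avg_nonneg)
  then have inf: "s * (cube_avg J (\<lambda>S. \<bar>h S\<bar>))\<^sup>2 + s * (\<Sum>j\<in>J. (cube_avg J (\<lambda>S. \<bar>cube_deriv j g S\<bar>))\<^sup>2)
     \<le> s * (\<Sum>j\<in>insert i J. (?A (\<lambda>S. \<bar>cube_deriv j f S\<bar>))\<^sup>2)"
    using insert.hyps assms(2) by (simp add: inf_i distrib_left[symmetric] mult_left_mono)
  have "cube_avg J (\<lambda>S. (h S)\<^sup>2) * (1 + ln s) - s * (cube_avg J (\<lambda>S. \<bar>h S\<bar>))\<^sup>2 \<le> 4 * cube_energy J h"
    using cube_entropy_lower_bound[OF insert.hyps(1) assms(2), of h] cube_log_Sobolev[OF insert.hyps(1), of h]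
    by linarith
  moreover have "0 \<le> cube_avg J (\<lambda>S. (h S)\<^sup>2)"
    by (auto intro: cube_avg_nonneg)
  ultimately show ?case
    using insert.IH[of g] inf unfolding mean second energy by (simp add: algebra_simps)
qed

section \<open>From random signs to Gaussian variables\<close>

definition cube_sign :: "'i set \<Rightarrow> 'i \<Rightarrow> real" where
  "cube_sign S p = (if p \<in> S then 1 else - 1)"

text \<open>
  Each matrix entry \<open>i\<close> is approximated by a normalised sum of \<open>n\<close> signs, which makes a random matrix
  out of a point of the cube over the pairs \<open>(i, l)\<close> with \<open>l < n\<close>.
\<close>

definition walk :: "nat \<Rightarrow> ('i \<times> nat) set \<Rightarrow> 'i \<Rightarrow> real" where
  "walk n S i = (\<Sum>l<n. cube_sign S (i, l)) / sqrt (real n)"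

lemma cube_avg_square_sum_signs:
  assumes "finite J" "K \<subseteq> J"
  shows "cube_avg J (\<lambda>S. (\<Sum>p\<in>K. cube_sign S p)\<^sup>2) = card K"
proof -
  have "cube_avg J (\<lambda>S. (\<Sum>p\<in>K \<inter> J. cube_sign S p)\<^sup>2) = card (K \<inter> J)"
    using assms(1)
  proof (induction J rule: finite_induct)
    case (insert i J)
    have same: "(\<Sum>p\<in>K \<inter> J. cube_sign (insert i S) p) = (\<Sum>p\<in>K \<inter> J. cube_sign S p)" for S
      using insert.hyps by (intro sum.cong) (auto simp: cube_sign_def)
    show ?case
    proof (cases "i \<in> K")
      case True
      then have K: "K \<inter> insert i J = insert i (K \<inter> J)" by auto
      have fin: "finite (K \<inter> J)" "i \<notin> K \<inter> J" using insert.hyps by auto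
      have "cube_avg (insert i J) (\<lambda>S. (\<Sum>p\<in>K \<inter> insert i J. cube_sign S p)\<^sup>2)
        = cube_avg J (\<lambda>S. 1 + (\<Sum>p\<in>K \<inter> J. cube_sign S p)\<^sup>2)"
        unfolding cube_avg_insert[OF insert.hyps] K sum.insert[OF fin] same
      proof (rule cube_avg_cong)
        fix S assume "S \<subseteq> J"
        then have "i \<notin> S" using insert.hyps by auto
        then show "((cube_sign (insert i S) i + (\<Sum>p\<in>K \<inter> J. cube_sign S p))\<^sup>2
          + (cube_sign S i + (\<Sum>p\<in>K \<inter> J. cube_sign S p))\<^sup>2) / 2 = 1 + (\<Sum>p\<in>K \<inter> J. cube_sign S p)\<^sup>2"
          by (simp add: cube_sign_def power2_eq_square field_simps)
      qed
      also have "\<dots> = 1 + card (K \<inter> J)"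
        using insert.hyps insert.IH by (simp add: cube_avg_add)
      finally show ?thesis using K fin by simp
    next
      case False
      then have K: "K \<inter> insert i J = K \<inter> J" by auto
      show ?thesis
        unfolding K cube_avg_insert[OF insert.hyps] same using insert.IH by simp
    qed
  qed simp
  then show ?thesis using assms by (simp add: Int_absorb2)
qed

lemma cube_avg_abs_walk_le:
  assumes "finite I" "i \<in> I"
  shows "cube_avg (I \<times> {..<n}) (\<lambda>S. \<bar>walk n S i\<bar>) \<le> 1"
proof -
  let ?J = "I \<times> {..<n}"
  have fin: "finite ?J" using assms by simp
  have "(\<Sum>l<n. cube_sign S (i, l)) = (\<Sum>p\<in>{i} \<times> {..<n}. cube_sign S p)" for S :: "('a \<times> nat) set"
    by (simp add: sum.cartesian_product' )
  then have "cube_avg ?J (\<lambda>S. (walk n S i)\<^sup>2) = real n / real n"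
    using cube_avg_square_sum_signs[OF fin, of "{i} \<times> {..<n}"] assms
    by (simp add: walk_def power_divide cube_avg_divide Sigma_mono)
  also have "\<dots> \<le> 1" by simp
  finally have "(cube_avg ?J (\<lambda>S. \<bar>walk n S i\<bar>))\<^sup>2 \<le> 1"
    using cube_avg_square_le[OF fin, of "\<lambda>S. \<bar>walk n S i\<bar>"] by simp
  then show ?thesis
    using power2_le_imp_le[of _ 1] by (metis one_power2 zero_le_one)
qed

text \<open>
  The margin is an infimum over sets that may be uncountable, hence not obviously measurable; its
  Lipschitz continuity settles the matter.
\<close>

lemma Lipschitz_coordinates_measurable:
  fixes F :: "('i::countable \<Rightarrow> real) \<Rightarrow> real"
  assumes I: "finite I" and Lip: "\<And>A B. \<bar>F A - F B\<bar> \<le> (\<Sum>i\<in>I. \<bar>A i - B i\<bar>)"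
  shows "F \<in> borel_measurable (PiM I (\<lambda>_. borel))"
proof -
  have "isCont F A" for A
  proof -
    have co: "((\<lambda>B. B i) \<longlongrightarrow> A i) (at A)" for i :: 'i
      using continuous_on_product_coordinates[of i]
      by (auto simp: continuous_on_def)
    have "((\<lambda>B. \<Sum>i\<in>I. \<bar>B i - A i\<bar>) \<longlongrightarrow> (\<Sum>i\<in>I. \<bar>A i - A i\<bar>)) (at A)"
      by (intro tendsto_intros co)
    then have "((\<lambda>B. F B - F A) \<longlongrightarrow> 0) (at A)"
      by (intro Lim_null_comparison[of "\<lambda>B. F B - F A" "\<lambda>B. \<Sum>i\<in>I. \<bar>B i - A i\<bar>"]) (auto simp: Lip)
    then show ?thesis
      unfolding isCont_def by (simp add: Lim_null[of F])
  qed
  then have "continuous_on UNIV F"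
    by (simp add: continuous_at_imp_continuous_on)
  then have F: "F \<in> borel_measurable borel"
    by (rule borel_measurable_continuous_onI)
  let ?\<rho> = "\<lambda>\<omega>. \<lambda>i. if i \<in> I then \<omega> i else (0::real)"
  have "?\<rho> \<in> measurable (PiM I (\<lambda>_. borel)) (PiM UNIV (\<lambda>_. borel))"
  proof (rule measurable_PiM_single')
    fix i :: 'i
    show "(\<lambda>\<omega>. if i \<in> I then \<omega> i else (0::real)) \<in> measurable (PiM I (\<lambda>_. borel)) borel"
      by (cases "i \<in> I") auto
  qed auto
  moreover have "measurable (PiM I (\<lambda>_. borel)) (PiM UNIV (\<lambda>_. borel)) =
     measurable (PiM I (\<lambda>_. borel)) (borel :: ('i \<Rightarrow> real) measure)"
    by (intro measurable_cong_sets refl sets_PiM_equal_borel)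
  ultimately have "(\<lambda>\<omega>. F (?\<rho> \<omega>)) \<in> borel_measurable (PiM I (\<lambda>_. borel))"
    using measurable_compose[OF _ F] by auto
  moreover have "F (?\<rho> \<omega>) = F \<omega>" for \<omega>
    using Lip[of "?\<rho> \<omega>" \<omega>] by simp
  ultimately show ?thesis by simp
qed

lemma indep_vars_PiM_coordinates:
  assumes M: "\<And>i. i \<in> K \<Longrightarrow> prob_space (M i)" and f: "inj_on f I" "f ` I \<subseteq> K" and I: "I \<noteq> {}"
  shows "prob_space.indep_vars (PiM K M) (\<lambda>i. M (f i)) (\<lambda>i \<omega>. \<omega> (f i)) I"
proof -
  interpret prob_space "PiM K M" by (rule prob_space_PiM[OF M])
  have "distr (PiM K M) (\<Pi>\<^sub>M i\<in>I. M (f i)) (\<lambda>\<omega>. \<lambda>i\<in>I. \<omega> (f i)) = (\<Pi>\<^sub>M i\<in>I. M (f i))"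
    using f by (intro distr_PiM_reindex M) auto
  also have "\<dots> = (\<Pi>\<^sub>M i\<in>I. distr (PiM K M) (M (f i)) (\<lambda>\<omega>. \<omega> (f i)))"
    using f by (intro PiM_cong refl distr_PiM_component[symmetric] M) auto
  finally show ?thesis
    using f by (subst indep_vars_iff_distr_eq_PiM'[OF I]) (auto intro!: measurable_component_singleton)
qed

abbreviation fair_coin :: "bool measure" where
  "fair_coin \<equiv> measure_pmf (bernoulli_pmf (1/2))"

abbreviation coins :: "('i \<Rightarrow> bool) measure" where
  "coins \<equiv> PiM UNIV (\<lambda>_. fair_coin)"

lemma prob_space_coins: "prob_space coins"
  by (intro prob_space_PiM) (simp add: measure_pmf.prob_space_axioms)

lemma coins_pattern_measurable [measurable]:
  assumes "finite J"
  shows "{\<omega>. {p \<in> J. \<omega> p} = S} \<in> sets coins"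
proof -
  have "{\<omega> \<in> space coins. \<forall>p\<in>J. \<omega> p = (p \<in> S)} \<in> sets (coins :: ('a \<Rightarrow> bool) measure)"
    using assms by measurable
  moreover have "{\<omega>. {p \<in> J. \<omega> p} = S} =
     (if S \<subseteq> J then {\<omega> \<in> space coins. \<forall>p\<in>J. \<omega> p = (p \<in> S)} else {})"
    by (auto simp: space_PiM)
  ultimately show ?thesis by auto
qed

lemma coins_pattern_prob:
  assumes "finite J" "S \<subseteq> J"
  shows "emeasure coins {\<omega>. {p \<in> J. \<omega> p} = S} = ennreal (1 / 2 ^ card J)"
proof -
  interpret product_prob_space "\<lambda>_. fair_coin" UNIV
    by (intro product_prob_spaceI measure_pmf.prob_space_axioms)
  have "{\<omega>. {p \<in> J. \<omega> p} = S} = {\<omega> \<in> space coins. \<forall>p\<in>J. \<omega> p \<in> {p \<in> S}}"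
    using assms by (auto simp: space_PiM)
  then have "emeasure coins {\<omega>. {p \<in> J. \<omega> p} = S} = (\<Prod>p\<in>J. emeasure fair_coin {p \<in> S})"
    using assms(1) by (simp only:) (subst emeasure_PiM_Collect, auto)
  also have "\<dots> = (\<Prod>p\<in>J. ennreal (1 / 2))"
    by (intro prod.cong refl) (auto simp: emeasure_pmf_single)
  also have "\<dots> = ennreal (1 / 2 ^ card J)"
    by (simp only: prod_constant, subst ennreal_power) (auto simp: power_divide)
  finally show ?thesis .
qed

text \<open>
  Averages over finite cubes of every size are integrals over a single space of coin tosses, which is
  the setting that the central limit theorem asks for.
\<close>

lemma nn_integral_coins:
  assumes J: "finite J" and g: "\<And>S. S \<subseteq> J \<Longrightarrow> 0 \<le> g S"
  shows "(\<integral>\<^sup>+\<omega>. ennreal (g {p \<in> J. \<omega> p}) \<partial>coins) = ennreal (cube_avg J g)"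
proof -
  have fin: "finite (Pow J)" using J by simp
  have "(\<integral>\<^sup>+\<omega>. ennreal (g {p \<in> J. \<omega> p}) \<partial>coins)
    = (\<integral>\<^sup>+\<omega>. (\<Sum>S\<in>Pow J. ennreal (g S) * indicator {\<omega>. {p \<in> J. \<omega> p} = S} \<omega>) \<partial>coins)"
  proof (intro nn_integral_cong)
    fix \<omega> :: "'a \<Rightarrow> bool"
    have "(\<Sum>S\<in>Pow J. ennreal (g S) * indicator {\<omega>. {p \<in> J. \<omega> p} = S} \<omega>)
      = (\<Sum>S\<in>Pow J. if S = {p \<in> J. \<omega> p} then ennreal (g S) else 0)"
      by (intro sum.cong) (auto simp: indicator_def)
    then show "ennreal (g {p \<in> J. \<omega> p}) = (\<Sum>S\<in>Pow J. ennreal (g S) * indicator {\<omega>. {p \<in> J. \<omega> p} = S} \<omega>)"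
      using fin by (simp add: sum.delta)
  qed
  also have "\<dots> = (\<Sum>S\<in>Pow J. ennreal (g S) * emeasure coins {\<omega>. {p \<in> J. \<omega> p} = S})"
    using J by (subst nn_integral_sum) (auto intro!: sum.cong nn_integral_cmult_indicator)
  also have "\<dots> = (\<Sum>S\<in>Pow J. ennreal (g S / 2 ^ card J))"
    using J g by (intro sum.cong) (auto simp: coins_pattern_prob ennreal_mult[symmetric])
  also have "\<dots> = ennreal (cube_avg J g)"
    unfolding cube_avg_def sum_divide_distrib using g by (intro sum_ennreal) auto
  finally show ?thesis .
qed

lemma coin_walk_CLT:
  "weak_conv_m (\<lambda>n. distr coins borel (\<lambda>\<omega>. walk n {p. \<omega> p} i)) std_normal_distribution"
proof -
  let ?P = "coins :: ('a \<times> nat \<Rightarrow> bool) measure"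
  interpret prob_space ?P by (rule prob_space_coins)
  let ?s = "\<lambda>b. if b then 1 else (- 1::real)"
  let ?X = "\<lambda>l \<omega>. ?s (\<omega> (i, l))"
  have law: "distr ?P borel (?X l) = distr fair_coin borel ?s" for l
  proof -
    have "distr ?P fair_coin (\<lambda>\<omega>. \<omega> (i, l)) = fair_coin"
      by (rule distr_PiM_component) (auto intro: measure_pmf.prob_space_axioms)
    then have "distr fair_coin borel ?s = distr (distr ?P fair_coin (\<lambda>\<omega>. \<omega> (i, l))) borel ?s" by simp
    also have "\<dots> = distr ?P borel (?X l)"
      by (subst distr_distr) (auto simp: comp_def)
    finally show ?thesis by simp
  qed
  have meas [measurable]: "?X l \<in> borel_measurable ?P" for l
    by measurable
  have mean: "expectation (?X l) = 0" for l
  proof -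
    have "expectation (?X l) = (\<integral>x. x \<partial>distr ?P borel (?X l))"
      by (subst integral_distr) auto
    also have "\<dots> = measure_pmf.expectation (bernoulli_pmf (1/2)) ?s"
      unfolding law by (subst integral_distr) auto
    also have "\<dots> = 0"
      by (subst integral_measure_pmf[of UNIV]) (auto simp: UNIV_bool)
    finally show ?thesis .
  qed
  have sq: "(?X l \<omega>)\<^sup>2 = 1" for l \<omega> by simp
  have "indep_vars (\<lambda>_. fair_coin) (\<lambda>l \<omega>. \<omega> (i, l)) UNIV"
    using indep_vars_PiM_coordinates[of UNIV "\<lambda>_. fair_coin" "\<lambda>l. (i, l)" UNIV]
    by (auto simp: inj_on_def measure_pmf.prob_space_axioms)
  then have indep: "indep_vars (\<lambda>_. borel) ?X UNIV"
    by (rule indep_vars_compose2) auto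
  have "weak_conv_m (\<lambda>n. distr ?P borel (\<lambda>\<omega>. (\<Sum>l<n. ?X l \<omega>) / sqrt (real n * 1\<^sup>2))) std_normal_distribution"
    using indep by (rule central_limit_theorem_zero_mean[OF _ mean _ _ _ law])
       (simp_all only: mean sq diff_zero, simp_all add: prob_space)
  moreover have "(\<lambda>\<omega>. (\<Sum>l<n. ?X l \<omega>) / sqrt (real n * 1\<^sup>2)) = (\<lambda>\<omega>. walk n {p. \<omega> p} i)" for n
    by (simp add: walk_def cube_sign_def)
  ultimately show ?thesis by simp
qed

text \<open>
  The mean minimises the second moment about a point, so that any centre \<open>c\<close> gives an upper bound.
\<close>

lemma (in prob_space) integrable_square_variance_le:
  fixes f :: "'a \<Rightarrow> real"
  assumes f [measurable]: "f \<in> borel_measurable M"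
    and V: "0 \<le> V" and bound: "(\<integral>\<^sup>+x. ennreal ((f x - c)\<^sup>2) \<partial>M) \<le> ennreal V"
  shows "integrable M (\<lambda>x. (f x)\<^sup>2)" and "variance f \<le> V"
proof -
  have int: "integrable M (\<lambda>x. (f x - c)\<^sup>2)"
    using bound by (intro integrableI_bounded) (auto intro: le_less_trans)
  have "integrable M (\<lambda>x. 2 * (f x - c)\<^sup>2 + 2 * c\<^sup>2)"
    using int by simp
  then show sq: "integrable M (\<lambda>x. (f x)\<^sup>2)"
  proof (rule Bochner_Integration.integrable_bound)
    have "(f x)\<^sup>2 \<le> 2 * (f x - c)\<^sup>2 + 2 * c\<^sup>2" for x
      using zero_le_power2[of "f x - 2 * c"] by (simp add: power2_eq_square algebra_simps)
    then show "AE x in M. norm ((f x)\<^sup>2) \<le> norm (2 * (f x - c)\<^sup>2 + 2 * c\<^sup>2)"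
      by (auto intro!: AE_I2 order_trans[OF _ abs_ge_self])
  qed simp
  then have f1: "integrable M f"
    by (rule square_integrable_imp_integrable[OF f])
  have "variance f = expectation (\<lambda>x. (f x - c)\<^sup>2) - (expectation f - c)\<^sup>2"
    using f1 sq by (simp add: variance_eq power2_diff prob_space power2_eq_square algebra_simps)
  also have "\<dots> \<le> expectation (\<lambda>x. (f x - c)\<^sup>2)" by simp
  also have "ennreal \<dots> \<le> ennreal V"
    using bound int by (subst nn_integral_eq_integral[symmetric]) auto
  then have "expectation (\<lambda>x. (f x - c)\<^sup>2) \<le> V"
    using V by simp
  finally show "variance f \<le> V" .
qed

text \<open>
  Boundedness in \<open>n\<close> is what matters: the means then have a convergent subsequence, and its limit can
  serve as the centre in the previous lemma.
\<close>

lemma cube_mean_walk_bounded: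
  fixes F :: "('i \<Rightarrow> real) \<Rightarrow> real"
  assumes I: "finite I" and Lip: "\<And>A B. \<bar>F A - F B\<bar> \<le> (\<Sum>i\<in>I. \<bar>A i - B i\<bar>)"
  shows "\<bar>cube_avg (I \<times> {..<n}) (\<lambda>S. F (walk n S))\<bar> \<le> \<bar>F (\<lambda>_. 0)\<bar> + card I"
proof -
  let ?J = "I \<times> {..<n}"
  have fin: "finite ?J" using I by simp
  have "\<bar>cube_avg ?J (\<lambda>S. F (walk n S))\<bar> \<le> cube_avg ?J (\<lambda>S. \<bar>F (walk n S)\<bar>)"
    unfolding cube_avg_def by (simp add: divide_right_mono sum_abs)
  also have "\<dots> \<le> cube_avg ?J (\<lambda>S. \<bar>F (\<lambda>_. 0)\<bar> + (\<Sum>i\<in>I. \<bar>walk n S i\<bar>))"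
  proof (intro cube_avg_mono)
    fix S
    show "\<bar>F (walk n S)\<bar> \<le> \<bar>F (\<lambda>_. 0)\<bar> + (\<Sum>i\<in>I. \<bar>walk n S i\<bar>)"
      using Lip[of "walk n S" "\<lambda>_. 0"] by simp
  qed
  also have "\<dots> = \<bar>F (\<lambda>_. 0)\<bar> + (\<Sum>i\<in>I. cube_avg ?J (\<lambda>S. \<bar>walk n S i\<bar>))"
    using fin by (simp add: cube_avg_add cube_avg_sum)
  also have "(\<Sum>i\<in>I. cube_avg ?J (\<lambda>S. \<bar>walk n S i\<bar>)) \<le> (\<Sum>i\<in>I. 1)"
    by (intro sum_mono cube_avg_abs_walk_le I)
  finally show ?thesis by simp
qed

lemma indep_vars_coin_walks:
  assumes I: "I \<noteq> {}"
  shows "prob_space.indep_vars coins (\<lambda>_. borel) (\<lambda>i \<omega>. walk n {p. \<omega> p} i) I"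
proof -
  let ?P = "coins :: ('a \<times> nat \<Rightarrow> bool) measure"
  interpret prob_space ?P by (rule prob_space_coins)
  let ?W = "\<lambda>i \<eta>. (\<Sum>l<n. if \<eta> (i, l) then 1 else (- 1::real)) / sqrt (real n)"
  have "indep_vars (\<lambda>_. fair_coin) (\<lambda>p \<omega>. \<omega> p) UNIV"
    using indep_vars_PiM_coordinates[of UNIV "\<lambda>_. fair_coin" "\<lambda>p. p" UNIV]
    by (auto simp: measure_pmf.prob_space_axioms)
  then have "indep_vars (\<lambda>i. PiM ({i} \<times> UNIV) (\<lambda>_. fair_coin)) (\<lambda>i \<omega>. \<lambda>p\<in>{i} \<times> UNIV. \<omega> p) I"
    by (rule indep_vars_restrict) (auto simp: disjoint_family_on_def)
  then have "indep_vars (\<lambda>_. borel) (\<lambda>i \<omega>. ?W i (\<lambda>p\<in>{i} \<times> UNIV. \<omega> p)) I"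
  proof (rule indep_vars_compose2)
    fix i assume "i \<in> I"
    have [measurable]: "(\<lambda>\<eta>. \<eta> (i, l)) \<in> measurable (PiM ({i} \<times> UNIV) (\<lambda>_. fair_coin)) (count_space UNIV)" for l
      using measurable_component_singleton[of "(i, l)" "{i} \<times> UNIV" "\<lambda>_. fair_coin"] by simp
    show "?W i \<in> borel_measurable (PiM ({i} \<times> UNIV) (\<lambda>_. fair_coin))"
      by measurable
  qed
  then show ?thesis by (simp add: walk_def cube_sign_def)
qed

text \<open>
  For each entry separately, the central limit theorem and Skorohod's theorem give variables with the
  laws of the walks that converge everywhere to a standard normal variable. On the product of these
  spaces the random matrices converge entrywise, hence so do the values of \<open>F\<close>, and Fatou's lemma bounds
  the second moment of the limit about a limit point of the means. The same bound yields the square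
  integrability of \<open>F\<close>.
\<close>

theorem gaussian_variance_le_cube_variance:
  fixes F :: "('i::countable \<Rightarrow> real) \<Rightarrow> real"
  assumes I: "finite I" "I \<noteq> {}" and Lip: "\<And>A B. \<bar>F A - F B\<bar> \<le> (\<Sum>i\<in>I. \<bar>A i - B i\<bar>)"
    and V0: "0 \<le> V"
    and V: "\<forall>\<^sub>F n in sequentially. cube_variance (I \<times> {..<n}) (\<lambda>S. F (walk n S)) \<le> V"
  shows "integrable (PiM I (\<lambda>_. std_normal_distribution)) (\<lambda>A. (F A)\<^sup>2)"
    and "prob_space.variance (PiM I (\<lambda>_. std_normal_distribution)) F \<le> V"
proof -
  let ?G = "PiM I (\<lambda>_. std_normal_distribution)"
  let ?P = "coins :: ('i \<times> nat \<Rightarrow> bool) measure"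
  let ?B = "PiM I (\<lambda>_. borel :: real measure)"
  let ?W = "\<lambda>n i \<omega>. walk n {p. \<omega> p} i"
  interpret P: prob_space ?P by (rule prob_space_coins)
  have std: "prob_space std_normal_distribution"
    by (intro prob_space_normal_density) simp
  interpret G: prob_space ?G
    by (intro prob_space_PiM std)
  have F [measurable]: "F \<in> borel_measurable ?B"
    by (rule Lipschitz_coordinates_measurable[OF I(1) Lip])
  have W [measurable]: "?W n i \<in> borel_measurable ?P" for n i
    unfolding walk_def cube_sign_def by simp
  have Fcong: "F A = F B" if "\<And>i. i \<in> I \<Longrightarrow> A i = B i" for A B
    using Lip[of A B] that by simp

  define coupled where "coupled i \<Omega> Y_seq Y \<longleftrightarrow>
    prob_space \<Omega> \<and>
    (\<forall>n. Y_seq n \<in> measurable \<Omega> borel) \<and>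
    (\<forall>n. distr \<Omega> borel (Y_seq n) = distr ?P borel (?W n i)) \<and>
    Y \<in> measurable \<Omega> lborel \<and>
    distr \<Omega> borel Y = std_normal_distribution \<and>
    (\<forall>x \<in> space \<Omega>. (\<lambda>n. Y_seq n x) \<longlonglongrightarrow> Y x)"
    for i and \<Omega> :: "real measure" and Y_seq :: "nat \<Rightarrow> real \<Rightarrow> real" and Y
  have "\<exists>\<Omega> Y_seq Y. coupled i \<Omega> Y_seq Y" for i :: 'i
    unfolding coupled_def
    by (intro Skorohod coin_walk_CLT real_dist_normal_dist P.real_distribution_distr W)
  then obtain \<Omega> Y_seq Y where "\<And>i. coupled i (\<Omega> i) (Y_seq i) (Y i)"
    by metis
  then have \<Omega>: "\<And>i. prob_space (\<Omega> i)" and Ys [measurable]: "\<And>i n. Y_seq i n \<in> borel_measurable (\<Omega> i)"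
    and Ys_law: "\<And>i n. distr (\<Omega> i) borel (Y_seq i n) = distr ?P borel (?W n i)"
    and Y': "\<And>i. Y i \<in> measurable (\<Omega> i) lborel"
    and Y_law: "\<And>i. distr (\<Omega> i) borel (Y i) = std_normal_distribution"
    and lim: "\<And>i x. x \<in> space (\<Omega> i) \<Longrightarrow> (\<lambda>n. Y_seq i n x) \<longlonglongrightarrow> Y i x"
    unfolding coupled_def by blast+
  have Y [measurable]: "Y i \<in> borel_measurable (\<Omega> i)" for i
    using Y'[of i] by simp
  let ?Q = "PiM I \<Omega>"
  interpret Q: prob_space ?Q by (intro prob_space_PiM \<Omega>)

  have joint: "distr ?Q ?B (\<lambda>\<omega>. \<lambda>i\<in>I. Z i (\<omega> i)) = PiM I (\<lambda>i. distr (\<Omega> i) borel (Z i))"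
    if Z [measurable]: "\<And>i. Z i \<in> borel_measurable (\<Omega> i)" for Z :: "'i \<Rightarrow> real \<Rightarrow> real"
  proof -
    have "Q.indep_vars \<Omega> (\<lambda>i \<omega>. \<omega> i) I"
      using indep_vars_PiM_coordinates[of I \<Omega> "\<lambda>i. i" I] I \<Omega> by auto
    then have "Q.indep_vars (\<lambda>_. borel) (\<lambda>i \<omega>. Z i (\<omega> i)) I"
      by (rule Q.indep_vars_compose2) (rule Z)
    then have "distr ?Q ?B (\<lambda>\<omega>. \<lambda>i\<in>I. Z i (\<omega> i)) = PiM I (\<lambda>i. distr ?Q borel (\<lambda>\<omega>. Z i (\<omega> i)))"
      by (subst (asm) Q.indep_vars_iff_distr_eq_PiM'[OF I(2)]) auto
    also have "\<dots> = PiM I (\<lambda>i. distr (distr ?Q (\<Omega> i) (\<lambda>\<omega>. \<omega> i)) borel (Z i))"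
      by (intro PiM_cong refl) (subst distr_distr, auto simp: comp_def)
    also have "\<dots> = PiM I (\<lambda>i. distr (\<Omega> i) borel (Z i))"
      by (intro PiM_cong refl arg_cong[where f="\<lambda>M. distr M borel _"] distr_PiM_component \<Omega>)
    finally show ?thesis .
  qed
  have law: "distr ?Q ?B (\<lambda>\<omega>. \<lambda>i\<in>I. Y_seq i n (\<omega> i)) = distr ?P ?B (\<lambda>\<omega>. \<lambda>i\<in>I. ?W n i \<omega>)" for n
  proof -
    have "distr ?P ?B (\<lambda>\<omega>. \<lambda>i\<in>I. ?W n i \<omega>) = PiM I (\<lambda>i. distr ?P borel (?W n i))"
      using indep_vars_coin_walks[OF I(2), of n]
      by (subst (asm) P.indep_vars_iff_distr_eq_PiM'[OF I(2)]) auto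
    then show ?thesis
      using joint[of "\<lambda>i. Y_seq i n"] Ys_law by simp
  qed
  have law_Y: "distr ?Q ?B (\<lambda>\<omega>. \<lambda>i\<in>I. Y i (\<omega> i)) = ?G"
    using joint[of Y] Y_law by simp

  define c where "c n = cube_avg (I \<times> {..<n}) (\<lambda>S. F (walk n S))" for n
  have cube: "(\<integral>\<^sup>+\<omega>. ennreal ((F (\<lambda>i\<in>I. Y_seq i n (\<omega> i)) - c n)\<^sup>2) \<partial>?Q)
     = ennreal (cube_variance (I \<times> {..<n}) (\<lambda>S. F (walk n S)))" for n
  proof -
    let ?J = "I \<times> {..<n}"
    have J: "finite ?J" using I by simp
    have "(\<integral>\<^sup>+\<omega>. ennreal ((F (\<lambda>i\<in>I. Y_seq i n (\<omega> i)) - c n)\<^sup>2) \<partial>?Q)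
      = (\<integral>\<^sup>+A. ennreal ((F A - c n)\<^sup>2) \<partial>distr ?Q ?B (\<lambda>\<omega>. \<lambda>i\<in>I. Y_seq i n (\<omega> i)))"
      by (subst nn_integral_distr) auto
    also have "\<dots> = (\<integral>\<^sup>+\<omega>. ennreal ((F (\<lambda>i\<in>I. ?W n i \<omega>) - c n)\<^sup>2) \<partial>?P)"
      unfolding law by (subst nn_integral_distr) auto
    also have "\<dots> = (\<integral>\<^sup>+\<omega>. ennreal ((F (walk n {p \<in> ?J. \<omega> p}) - c n)\<^sup>2) \<partial>?P)"
      by (intro nn_integral_cong arg_cong[where f="\<lambda>x. ennreal ((x - c n)\<^sup>2)"] Fcong)
         (auto simp: walk_def cube_sign_def)
    also have "\<dots> = ennreal (cube_avg ?J (\<lambda>S. (F (walk n S) - c n)\<^sup>2))"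
      by (rule nn_integral_coins[OF J]) simp
    finally show ?thesis
      by (simp add: cube_variance_eq[OF J] c_def)
  qed

  have "bounded (range c)"
    unfolding bounded_iff using cube_mean_walk_bounded[OF I(1) Lip] by (auto simp: c_def)
  then obtain l r where r: "strict_mono r" and cl: "(c \<circ> r) \<longlonglongrightarrow> l"
    using bounded_imp_convergent_subsequence by blast
  have V_r: "\<forall>\<^sub>F n in sequentially. cube_variance (I \<times> {..<r n}) (\<lambda>S. F (walk (r n) S)) \<le> V"
    using eventually_subseq[OF r V] .

  have conv: "(\<lambda>n. ennreal ((F (\<lambda>i\<in>I. Y_seq i (r n) (\<omega> i)) - c (r n))\<^sup>2))
     \<longlonglongrightarrow> ennreal ((F (\<lambda>i\<in>I. Y i (\<omega> i)) - l)\<^sup>2)" if \<omega>: "\<omega> \<in> space ?Q" for \<omega>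
  proof -
    have coord: "(\<lambda>n. Y_seq i (r n) (\<omega> i)) \<longlonglongrightarrow> Y i (\<omega> i)" if "i \<in> I" for i
      using LIMSEQ_subseq_LIMSEQ[OF lim r, of "\<omega> i" i] \<omega> that by (auto simp: space_PiM comp_def)
    have "(\<lambda>n. \<Sum>i\<in>I. \<bar>Y_seq i (r n) (\<omega> i) - Y i (\<omega> i)\<bar>) \<longlonglongrightarrow> (\<Sum>i\<in>I. \<bar>Y i (\<omega> i) - Y i (\<omega> i)\<bar>)"
      by (intro tendsto_intros coord)
    then have "(\<lambda>n. \<Sum>i\<in>I. \<bar>Y_seq i (r n) (\<omega> i) - Y i (\<omega> i)\<bar>) \<longlonglongrightarrow> 0"
      by simp
    then have "(\<lambda>n. F (\<lambda>i\<in>I. Y_seq i (r n) (\<omega> i)) - F (\<lambda>i\<in>I. Y i (\<omega> i))) \<longlonglongrightarrow> 0"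
    proof (rule Lim_null_comparison[OF always_eventually, rotated])
      show "\<forall>n. norm (F (\<lambda>i\<in>I. Y_seq i (r n) (\<omega> i)) - F (\<lambda>i\<in>I. Y i (\<omega> i)))
        \<le> (\<Sum>i\<in>I. \<bar>Y_seq i (r n) (\<omega> i) - Y i (\<omega> i)\<bar>)"
        unfolding real_norm_def
        by (intro allI order_trans[OF Lip] eq_refl sum.cong) auto
    qed
    then have "(\<lambda>n. F (\<lambda>i\<in>I. Y_seq i (r n) (\<omega> i))) \<longlonglongrightarrow> F (\<lambda>i\<in>I. Y i (\<omega> i))"
      by (subst Lim_null)
    then show ?thesis
      using cl by (intro tendsto_ennrealI tendsto_intros) (auto simp: comp_def)
  qed

  have "(\<integral>\<^sup>+A. ennreal ((F A - l)\<^sup>2) \<partial>?G) = (\<integral>\<^sup>+\<omega>. ennreal ((F (\<lambda>i\<in>I. Y i (\<omega> i)) - l)\<^sup>2) \<partial>?Q)"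
    unfolding law_Y[symmetric] by (subst nn_integral_distr) auto
  also have "\<dots> = (\<integral>\<^sup>+\<omega>. liminf (\<lambda>n. ennreal ((F (\<lambda>i\<in>I. Y_seq i (r n) (\<omega> i)) - c (r n))\<^sup>2)) \<partial>?Q)"
    by (intro nn_integral_cong lim_imp_Liminf[symmetric] conv) simp_all
  also have "\<dots> \<le> liminf (\<lambda>n. \<integral>\<^sup>+\<omega>. ennreal ((F (\<lambda>i\<in>I. Y_seq i (r n) (\<omega> i)) - c (r n))\<^sup>2) \<partial>?Q)"
    by (rule nn_integral_liminf) measurable
  also have "\<dots> \<le> ennreal V"
    unfolding cube using V_r
    by (intro Liminf_le) (auto elim!: eventually_mono intro: ennreal_leI)
  finally have bound: "(\<integral>\<^sup>+A. ennreal ((F A - l)\<^sup>2) \<partial>?G) \<le> ennreal V" .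
  have "sets ?G = sets ?B" by (intro sets_PiM_cong) auto
  then have "F \<in> borel_measurable ?G"
    using F by (simp cong: measurable_cong_sets)
  from G.integrable_square_variance_le[OF this V0 bound]
  show "integrable ?G (\<lambda>A. (F A)\<^sup>2)" "prob_space.variance ?G F \<le> V" .
qed

section \<open>The \<open>\<ell>\<^sup>q\<close> norms\<close>

lemma powr_convex_nonneg:
  fixes u v a b q :: real
  assumes "q \<ge> 1" "u \<ge> 0" "v \<ge> 0" "a \<ge> 0" "b \<ge> 0" "a + b = 1"
  shows "(a * u + b * v) powr q \<le> a * u powr q + b * v powr q"
proof -
  have shrink: "c powr q \<le> c" if "0 \<le> c" "c \<le> 1" for c :: real
    using powr_mono'[of 1 q c] that assms(1) by simp
  show ?thesis
  proof (cases "u = 0 \<or> v = 0")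
    case True
    then show ?thesis
      using assms shrink[of a] shrink[of b] by (auto simp: powr_mult intro!: mult_right_mono)
  next
    case False
    have a: "1 - b = a" using assms by simp
    show ?thesis
      using convex_onD[OF powr_convex[OF assms(1)], of b u v] False assms unfolding a by simp
  qed
qed

lemma lq_norm_real:
  "lq_norm (ereal q) n x = (\<Sum>i<n. \<bar>x i\<bar> powr q) powr (1 / q)"
  by (simp add: lq_norm_def)

lemma lq_norm_powr:
  assumes "q > 0"
  shows "lq_norm (ereal q) n x powr q = (\<Sum>i<n. \<bar>x i\<bar> powr q)"
  using assms by (simp add: lq_norm_real powr_powr sum_nonneg)

lemma lq_norm_le_iff:
  assumes "q > 0" "c \<ge> 0"
  shows "lq_norm (ereal q) n x \<le> c \<longleftrightarrow> (\<Sum>i<n. \<bar>x i\<bar> powr q) \<le> c powr q"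
proof -
  have "lq_norm (ereal q) n x \<ge> 0" by (simp add: lq_norm_real)
  then show ?thesis
    unfolding lq_norm_powr[OF assms(1), symmetric]
    using assms powr_mono2[of q "lq_norm (ereal q) n x" c] powr_less_mono2[of q c "lq_norm (ereal q) n x"]
    by (cases "lq_norm (ereal q) n x \<le> c") auto
qed

lemma lq_norm_infinity_le_iff:
  assumes "n \<ge> 1"
  shows "lq_norm \<infinity> n x \<le> c \<longleftrightarrow> (\<forall>i<n. \<bar>x i\<bar> \<le> c)"
  using assms by (auto simp: lq_norm_def lessThan_empty_iff)

lemma abs_le_lq_norm_infinity: "i < n \<Longrightarrow> \<bar>x i\<bar> \<le> lq_norm \<infinity> n x"
  by (simp add: lq_norm_def)

lemma lq_exponent_cases:
  fixes q :: ereal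
  assumes "2 \<le> q"
  obtains (real) r where "q = ereal r" "2 \<le> r" | (infinity) "q = \<infinity>"
  using assms by (cases q) auto

lemma lq_norm_nonneg:
  assumes "n \<ge> 1"
  shows "0 \<le> lq_norm q n x"
proof (cases "q = \<infinity>")
  case True
  then show ?thesis
    using order_trans[OF abs_ge_zero abs_le_lq_norm_infinity[of 0 n x]] assms by simp
qed (simp add: lq_norm_def)

lemma lq_norm_scale:
  assumes q: "2 \<le> q" and n: "n \<ge> 1" and c: "c \<ge> 0"
  shows "lq_norm q n (\<lambda>i. c * x i) = c * lq_norm q n x"
  using q
proof (cases rule: lq_exponent_cases)
  case (real r)
  then show ?thesis
    using c by (simp add: lq_norm_real abs_mult powr_mult sum_distrib_left[symmetric] sum_nonneg powr_powr)
next
  case infinity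
  have "Max ((\<lambda>i. c * \<bar>x i\<bar>) ` {..<n}) = c * Max ((\<lambda>i. \<bar>x i\<bar>) ` {..<n})"
    using c n mono_Max_commute[of "(*) c" "(\<lambda>i. \<bar>x i\<bar>) ` {..<n}"]
    by (auto simp: mono_def mult_left_mono image_image lessThan_empty_iff)
  then show ?thesis using infinity c by (simp add: lq_norm_def abs_mult)
qed

text \<open>
  Minkowski's inequality: \<open>(x + y) / (a + b)\<close> is a convex combination of the vectors \<open>x / a\<close> and \<open>y / b\<close>
  of norm one, and \<open>t \<mapsto> t\<^sup>q\<close> is convex.
\<close>

lemma lq_norm_triangle:
  assumes q: "2 \<le> q" and n: "n \<ge> 1"
  shows "lq_norm q n (\<lambda>i. x i + y i) \<le> lq_norm q n x + lq_norm q n y"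
  using q
proof (cases rule: lq_exponent_cases)
  case infinity
  have "\<bar>x i + y i\<bar> \<le> lq_norm \<infinity> n x + lq_norm \<infinity> n y" if "i < n" for i
    using abs_le_lq_norm_infinity[OF that, of x] abs_le_lq_norm_infinity[OF that, of y] by linarith
  then show ?thesis using infinity n by (simp add: lq_norm_infinity_le_iff)
next
  case (real r)
  define a where "a = lq_norm q n x"
  define b where "b = lq_norm q n y"
  have ab: "a \<ge> 0" "b \<ge> 0" unfolding a_def b_def by (auto intro: lq_norm_nonneg[OF n])
  have sums: "(\<Sum>i<n. \<bar>x i\<bar> powr r) = a powr r" "(\<Sum>i<n. \<bar>y i\<bar> powr r) = b powr r"
    using real by (simp_all add: a_def b_def lq_norm_powr)
  have zero: "\<forall>i<n. v i = 0" if "(\<Sum>i<n. \<bar>v i\<bar> powr r) = 0" for v :: "nat \<Rightarrow> real"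
    using that by (subst (asm) sum_nonneg_eq_0_iff) auto
  show ?thesis
  proof (cases "a = 0 \<or> b = 0")
    case True
    then show ?thesis
    proof
      assume "a = 0"
      then have "\<forall>i<n. x i = 0" using sums real by (intro zero) simp
      then show ?thesis using ab unfolding a_def[symmetric] b_def by (simp add: real(1) lq_norm_real)
    next
      assume "b = 0"
      then have "\<forall>i<n. y i = 0" using sums real by (intro zero) simp
      then show ?thesis using ab unfolding b_def[symmetric] a_def by (simp add: real(1) lq_norm_real)
    qed
  next
    case False
    then have ab: "a > 0" "b > 0" using ab by auto
    define t where "t = a / (a + b)"
    have t: "t \<ge> 0" "1 - t \<ge> 0" "1 - t = b / (a + b)" using ab by (auto simp: t_def field_simps)
    have "\<bar>x i + y i\<bar> powr r \<le> (a + b) powr r * (t * (\<bar>x i\<bar> powr r / a powr r) + (1 - t) * (\<bar>y i\<bar> powr r / b powr r))"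
      for i
    proof -
      have "(a + b) * t = a" "(a + b) * (1 - t) = b"
        unfolding t(3) using ab by (simp_all add: t_def)
      then have "(a + b) * (t * (\<bar>x i\<bar> / a) + (1 - t) * (\<bar>y i\<bar> / b)) = a * (\<bar>x i\<bar> / a) + b * (\<bar>y i\<bar> / b)"
        by (simp only: distrib_left mult.assoc[symmetric])
      then have "\<bar>x i + y i\<bar> \<le> (a + b) * (t * (\<bar>x i\<bar> / a) + (1 - t) * (\<bar>y i\<bar> / b))"
        using ab abs_triangle_ineq[of "x i" "y i"] by simp
      then have "\<bar>x i + y i\<bar> powr r \<le> ((a + b) * (t * (\<bar>x i\<bar> / a) + (1 - t) * (\<bar>y i\<bar> / b))) powr r"
        using real by (intro powr_mono2) auto
      also have "\<dots> = (a + b) powr r * (t * (\<bar>x i\<bar> / a) + (1 - t) * (\<bar>y i\<bar> / b)) powr r"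
        using ab t by (intro powr_mult)
      also have "\<dots> \<le> (a + b) powr r * (t * (\<bar>x i\<bar> / a) powr r + (1 - t) * (\<bar>y i\<bar> / b) powr r)"
        using ab t real by (intro mult_left_mono powr_convex_nonneg) auto
      finally show ?thesis using ab by (simp add: powr_divide)
    qed
    then have "(\<Sum>i<n. \<bar>x i + y i\<bar> powr r)
      \<le> (\<Sum>i<n. (a + b) powr r * (t * (\<bar>x i\<bar> powr r / a powr r) + (1 - t) * (\<bar>y i\<bar> powr r / b powr r)))"
      by (intro sum_mono)
    also have "\<dots> = (a + b) powr r * (t * ((\<Sum>i<n. \<bar>x i\<bar> powr r) / a powr r)
        + (1 - t) * ((\<Sum>i<n. \<bar>y i\<bar> powr r) / b powr r))"
      by (simp only: sum_distrib_left[symmetric] sum.distrib sum_divide_distrib[symmetric])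
    also have "\<dots> = (a + b) powr r" unfolding sums using ab by simp
    finally show ?thesis
      unfolding a_def[symmetric] b_def[symmetric] using real ab by (simp add: lq_norm_le_iff)
  qed
qed

lemma lq_norm_le_L2:
  assumes q: "2 \<le> q" and n: "n \<ge> 1"
  shows "lq_norm q n x \<le> L2_set x {..<n}"
proof -
  define c where "c = L2_set x {..<n}"
  have c: "c \<ge> 0" by (simp add: c_def)
  have coord: "\<bar>x i\<bar> \<le> c" if "i < n" for i
    using that member_le_L2_set[of "{..<n}" i "\<lambda>i. \<bar>x i\<bar>"] by (simp add: c_def L2_set_def)
  show ?thesis using q
  proof (cases rule: lq_exponent_cases)
    case infinity
    then show ?thesis using coord n by (simp add: lq_norm_infinity_le_iff c_def)
  next
    case (real r)
    have "\<bar>x i\<bar> powr r \<le> (x i)\<^sup>2 * c powr (r - 2)" if "i < n" for i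
    proof (cases "x i = 0")
      case False
      have "\<bar>x i\<bar> powr r = \<bar>x i\<bar> powr 2 * \<bar>x i\<bar> powr (r - 2)"
        by (simp only: powr_add[symmetric]) simp
      also have "\<dots> \<le> \<bar>x i\<bar> powr 2 * c powr (r - 2)"
        using real coord[OF that] by (intro mult_left_mono powr_mono2) auto
      finally show ?thesis using False by (simp add: powr_numeral)
    qed (use c in simp)
    then have "(\<Sum>i<n. \<bar>x i\<bar> powr r) \<le> (\<Sum>i<n. (x i)\<^sup>2 * c powr (r - 2))"
      by (intro sum_mono) auto
    also have "\<dots> = c\<^sup>2 * c powr (r - 2)"
      by (simp add: sum_distrib_right[symmetric] c_def L2_set_def sum_nonneg)
    also have "\<dots> = c powr r"
    proof (cases "c = 0")
      case False
      then have "c\<^sup>2 = c powr 2" using c by (simp add: powr_numeral)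
      then show ?thesis by (simp flip: powr_add)
    qed (use real in simp)
    finally show ?thesis using real c by (simp add: lq_norm_le_iff c_def[symmetric])
  qed
qed

text \<open>
  By duality this bounds the \<open>\<ell>\<^sup>1\<close> norm, over the rows of a block, of a vector in the dual unit ball; the
  power of the block size in the final bound comes from here. The exponent is \<open>1 / q\<close>, and it is \<open>0\<close> for
  \<open>q = \<infinity>\<close>.
\<close>

lemma lq_norm_indicator_le:
  assumes q: "2 \<le> q" and n: "n \<ge> 1" and B: "B \<subseteq> {..<n}" "B \<noteq> {}"
    and x: "\<And>i. \<bar>x i\<bar> \<le> indicator B i"
  shows "lq_norm q n x \<le> real (card B) powr (real_of_ereal (2 / q) / 2)"
  using q
proof (cases rule: lq_exponent_cases)
  case infinity
  have "card B > 0" using B finite_subset by (auto simp: card_gt_0_iff)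
  moreover have "\<bar>x i\<bar> \<le> 1" for i using x[of i] indicator_le_1[of B i] by (rule order_trans)
  ultimately show ?thesis using infinity n by (simp add: lq_norm_infinity_le_iff)
next
  case (real r)
  have "(\<Sum>i<n. \<bar>x i\<bar> powr r) \<le> (\<Sum>i<n. indicator B i)"
  proof (intro sum_mono)
    fix i
    show "\<bar>x i\<bar> powr r \<le> indicator B i"
      using x[of i] real powr_le1[of r "\<bar>x i\<bar>"] by (auto simp: indicator_def split: if_splits)
  qed
  also have "\<dots> = (real (card B) powr (1 / r)) powr r"
  proof -
    have "(\<Sum>i<n. indicator B i) = (\<Sum>i\<in>B. (1::real))"
      using B by (intro sum.mono_neutral_cong_right) auto
    then show ?thesis using real by (simp add: powr_powr)
  qed
  finally have "lq_norm (ereal r) n x \<le> real (card B) powr (1 / r)"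
    using real by (subst lq_norm_le_iff) auto
  moreover have "2 / ereal r = ereal (2 / r)"
    using real by (simp add: numeral_eq_ereal)
  ultimately show ?thesis using real by simp
qed

lemma lq_norm_permute:
  assumes "\<pi> permutes {..<n}"
  shows "lq_norm q n (\<lambda>i. x (\<pi> i)) = lq_norm q n x"
proof -
  have "(\<lambda>i. \<bar>x (\<pi> i)\<bar>) ` {..<n} = (\<lambda>i. \<bar>x i\<bar>) ` {..<n}"
    unfolding image_image[of "\<lambda>i. \<bar>x i\<bar>" \<pi>, symmetric] permutes_image[OF assms] ..
  moreover have "(\<Sum>i<n. \<bar>x (\<pi> i)\<bar> powr a) = (\<Sum>i<n. \<bar>x i\<bar> powr a)" for a
    using sum.permute[OF assms, of "\<lambda>i. \<bar>x i\<bar> powr a"] by (simp add: comp_def)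
  ultimately show ?thesis by (simp add: lq_norm_def)
qed

section \<open>The smoothed margin\<close>

text \<open>
  The arguments use only a few properties of the \<open>\<ell>\<^sup>q\<close> norm, which is therefore an abstract function \<open>\<nu>\<close>.
\<close>

locale margin_problem =
  fixes M N :: nat and \<nu> :: "(nat \<Rightarrow> real) \<Rightarrow> real" and Q E :: "(nat \<Rightarrow> real) set"
  assumes nu_nonneg: "0 \<le> \<nu> x"
    and nu_triangle: "\<nu> (\<lambda>i. x i + y i) \<le> \<nu> x + \<nu> y"
    and nu_scale: "0 \<le> c \<Longrightarrow> \<nu> (\<lambda>i. c * x i) = c * \<nu> x"
    and nu_le_L2: "\<nu> x \<le> L2_set x {..<M}"
    and Q_nonempty: "Q \<noteq> {}" and E_nonempty: "E \<noteq> {}"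
    and Q_ball: "\<sigma> \<in> Q \<Longrightarrow> L2_set \<sigma> {..<N} \<le> 1"
begin

definition dist_margin :: "(nat \<times> nat \<Rightarrow> real) \<Rightarrow> real" where
  "dist_margin A = (INF \<sigma>\<in>Q. INF y\<in>E. \<nu> (\<lambda>i. mat_vec M N A \<sigma> i - y i))"

text \<open>
  The margin is not differentiable, neither as an infimum nor because of the norm. Replacing the norm of
  \<open>A \<sigma> - y\<close> by its Moreau envelope \<open>min\<^sub>z \<nu> z + \<parallel>A \<sigma> - y - z\<parallel>\<^sup>2 / (2 \<epsilon>)\<close> cures both defects at once: the
  margin becomes an infimum over \<open>\<sigma>\<close>, \<open>y\<close> and \<open>z\<close> of functions that are quadratic in \<open>A\<close> with second
  derivative at most \<open>1 / \<epsilon>\<close>, hence it is semiconcave.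
\<close>

definition penalty :: "real \<Rightarrow> (nat \<times> nat \<Rightarrow> real) \<Rightarrow> (nat \<Rightarrow> real) \<Rightarrow> (nat \<Rightarrow> real) \<Rightarrow> (nat \<Rightarrow> real) \<Rightarrow> real" where
  "penalty \<epsilon> A \<sigma> y z = \<nu> z + (\<Sum>i<M. (mat_vec M N A \<sigma> i - y i - z i)\<^sup>2) / (2 * \<epsilon>)"

definition smooth_margin :: "real \<Rightarrow> (nat \<times> nat \<Rightarrow> real) \<Rightarrow> real" where
  "smooth_margin \<epsilon> A = (INF (\<sigma>, y, z)\<in>Q \<times> E \<times> UNIV. penalty \<epsilon> A \<sigma> y z)"

lemma dist_margin_le:
  assumes "\<sigma> \<in> Q" "y \<in> E"
  shows "dist_margin A \<le> \<nu> (\<lambda>i. mat_vec M N A \<sigma> i - y i)"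
proof -
  have bdd: "bdd_below ((\<lambda>y. \<nu> (\<lambda>i. mat_vec M N A \<sigma> i - y i)) ` E)" for \<sigma>
    by (rule bdd_belowI2[of _ 0]) (rule nu_nonneg)
  have "bdd_below ((\<lambda>\<sigma>. INF y\<in>E. \<nu> (\<lambda>i. mat_vec M N A \<sigma> i - y i)) ` Q)"
    by (rule bdd_belowI2[of _ 0]) (intro cINF_greatest E_nonempty nu_nonneg)
  then have "dist_margin A \<le> (INF y\<in>E. \<nu> (\<lambda>i. mat_vec M N A \<sigma> i - y i))"
    unfolding dist_margin_def using assms(1) by (rule cINF_lower)
  also have "\<dots> \<le> \<nu> (\<lambda>i. mat_vec M N A \<sigma> i - y i)"
    using bdd assms(2) by (rule cINF_lower)
  finally show ?thesis .
qed

lemma dist_margin_greatest: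
  assumes "\<And>\<sigma> y. \<sigma> \<in> Q \<Longrightarrow> y \<in> E \<Longrightarrow> c \<le> \<nu> (\<lambda>i. mat_vec M N A \<sigma> i - y i)"
  shows "c \<le> dist_margin A"
  unfolding dist_margin_def using assms by (intro cINF_greatest Q_nonempty E_nonempty)

lemma penalty_nonneg: "\<epsilon> > 0 \<Longrightarrow> 0 \<le> penalty \<epsilon> A \<sigma> y z"
  by (simp add: penalty_def nu_nonneg sum_nonneg)

lemma smooth_margin_le:
  assumes "\<epsilon> > 0" "\<sigma> \<in> Q" "y \<in> E"
  shows "smooth_margin \<epsilon> A \<le> penalty \<epsilon> A \<sigma> y z"
proof -
  have "bdd_below ((\<lambda>(\<sigma>, y, z). penalty \<epsilon> A \<sigma> y z) ` (Q \<times> E \<times> UNIV))"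
    by (rule bdd_belowI2[of _ 0]) (auto simp: penalty_nonneg[OF assms(1)])
  from cINF_lower[OF this, of "(\<sigma>, y, z)"] show ?thesis
    using assms by (simp add: smooth_margin_def)
qed

lemma smooth_margin_greatest:
  assumes "\<And>\<sigma> y z. \<sigma> \<in> Q \<Longrightarrow> y \<in> E \<Longrightarrow> c \<le> penalty \<epsilon> A \<sigma> y z"
  shows "c \<le> smooth_margin \<epsilon> A"
  unfolding smooth_margin_def using assms Q_nonempty E_nonempty by (intro cINF_greatest) auto

lemma smooth_margin_near:
  assumes "\<eta> > 0"
  obtains \<sigma> y z where "\<sigma> \<in> Q" "y \<in> E" "penalty \<epsilon> A \<sigma> y z < smooth_margin \<epsilon> A + \<eta>"
  using smooth_margin_greatest[of "smooth_margin \<epsilon> A + \<eta>" \<epsilon> A] assms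
  by (metis add_le_same_cancel1 linorder_not_le)

lemma nu_cong_le: "\<nu> x \<le> \<nu> y + L2_set (\<lambda>i. x i - y i) {..<M}"
  using nu_triangle[of y "\<lambda>i. x i - y i"] nu_le_L2[of "\<lambda>i. x i - y i"] by simp

lemma smooth_margin_le_dist_margin:
  assumes "\<epsilon> > 0"
  shows "smooth_margin \<epsilon> A \<le> dist_margin A"
proof (rule dist_margin_greatest)
  fix \<sigma> y assume "\<sigma> \<in> Q" "y \<in> E"
  from smooth_margin_le[OF assms this, of A "\<lambda>i. mat_vec M N A \<sigma> i - y i"]
  show "smooth_margin \<epsilon> A \<le> \<nu> (\<lambda>i. mat_vec M N A \<sigma> i - y i)"
    by (simp add: penalty_def)
qed

lemma dist_margin_le_smooth_margin:
  assumes "\<epsilon> > 0"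
  shows "dist_margin A \<le> smooth_margin \<epsilon> A + \<epsilon> / 2"
proof -
  have "dist_margin A - \<epsilon> / 2 \<le> smooth_margin \<epsilon> A"
  proof (rule smooth_margin_greatest)
    fix \<sigma> y z assume *: "\<sigma> \<in> Q" "y \<in> E"
    define u where "u i = mat_vec M N A \<sigma> i - y i - z i" for i
    have "dist_margin A \<le> \<nu> z + L2_set u {..<M}"
      using dist_margin_le[OF *, of A] nu_cong_le[of "\<lambda>i. mat_vec M N A \<sigma> i - y i" z]
      by (simp add: u_def[abs_def])
    moreover have "L2_set u {..<M} \<le> (L2_set u {..<M})\<^sup>2 / (2 * \<epsilon>) + \<epsilon> / 2"
      using sum_squares_bound[of "L2_set u {..<M}" \<epsilon>] assms
      by (simp add: field_simps power2_eq_square)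
    moreover have "penalty \<epsilon> A \<sigma> y z = \<nu> z + (L2_set u {..<M})\<^sup>2 / (2 * \<epsilon>)"
      by (simp add: penalty_def u_def L2_set_def sum_nonneg)
    ultimately show "dist_margin A - \<epsilon> / 2 \<le> penalty \<epsilon> A \<sigma> y z" by linarith
  qed
  then show ?thesis by simp
qed

lemma Q_coordinate_le:
  assumes "\<sigma> \<in> Q" "j < N"
  shows "\<bar>\<sigma> j\<bar> \<le> 1"
proof -
  have "\<bar>\<sigma> j\<bar> \<le> L2_set (\<lambda>i. \<bar>\<sigma> i\<bar>) {..<N}"
    using assms(2) by (intro member_le_L2_set) auto
  also have "\<dots> = L2_set \<sigma> {..<N}" by (simp add: L2_set_def)
  also have "\<dots> \<le> 1" by (rule Q_ball[OF assms(1)])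
  finally show ?thesis .
qed

lemma Q_sum_squares_le:
  assumes "\<sigma> \<in> Q"
  shows "(\<Sum>j<N. (\<sigma> j)\<^sup>2) \<le> 1"
  using Q_ball[OF assms] by (simp add: L2_set_def sum_nonneg)

lemma dist_margin_Lipschitz:
  "\<bar>dist_margin A - dist_margin B\<bar> \<le> (\<Sum>i\<in>{..<M} \<times> {..<N}. \<bar>A i - B i\<bar>)"
proof -
  have le: "dist_margin A \<le> dist_margin B + (\<Sum>i\<in>{..<M} \<times> {..<N}. \<bar>A i - B i\<bar>)" for A B
  proof -
    have "dist_margin A - (\<Sum>i\<in>{..<M} \<times> {..<N}. \<bar>A i - B i\<bar>) \<le> dist_margin B"
    proof (rule dist_margin_greatest)
      fix \<sigma> y assume *: "\<sigma> \<in> Q" "y \<in> E"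
      let ?d = "\<lambda>i. mat_vec M N A \<sigma> i - mat_vec M N B \<sigma> i"
      have "L2_set ?d {..<M} \<le> (\<Sum>i<M. \<bar>?d i\<bar>)"
        by (rule L2_set_le_sum_abs)
      also have "\<dots> \<le> (\<Sum>i<M. \<Sum>j<N. \<bar>A (i, j) - B (i, j)\<bar>)"
      proof (intro sum_mono)
        fix i assume "i \<in> {..<M}"
        then have "?d i = (\<Sum>j<N. (A (i, j) - B (i, j)) * \<sigma> j)"
          by (simp add: mat_vec_def sum_subtractf left_diff_distrib)
        also have "\<bar>\<dots>\<bar> \<le> (\<Sum>j<N. \<bar>(A (i, j) - B (i, j)) * \<sigma> j\<bar>)"
          by (rule sum_abs)
        also have "\<dots> \<le> (\<Sum>j<N. \<bar>A (i, j) - B (i, j)\<bar>)"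
          using Q_coordinate_le[OF *(1)] by (intro sum_mono) (auto simp: abs_mult intro: mult_left_le)
        finally show "\<bar>?d i\<bar> \<le> (\<Sum>j<N. \<bar>A (i, j) - B (i, j)\<bar>)" .
      qed
      also have "\<dots> = (\<Sum>i\<in>{..<M} \<times> {..<N}. \<bar>A i - B i\<bar>)"
        by (simp add: sum.cartesian_product case_prod_beta)
      finally show "dist_margin A - (\<Sum>i\<in>{..<M} \<times> {..<N}. \<bar>A i - B i\<bar>) \<le> \<nu> (\<lambda>i. mat_vec M N B \<sigma> i - y i)"
        using dist_margin_le[OF *, of A]
          nu_cong_le[of "\<lambda>i. mat_vec M N A \<sigma> i - y i" "\<lambda>i. mat_vec M N B \<sigma> i - y i"] by simp
    qed
    then show ?thesis by simp
  qed
  have sym: "(\<Sum>i\<in>{..<M} \<times> {..<N}. \<bar>B i - A i\<bar>) = (\<Sum>i\<in>{..<M} \<times> {..<N}. \<bar>A i - B i\<bar>)"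
    by (intro sum.cong) auto
  show ?thesis using le[of A B] le[of B A] unfolding sym by linarith
qed

lemma mat_vec_update:
  assumes "r < M" "j < N"
  shows "mat_vec M N (A((r, j) := A (r, j) + t)) \<sigma> i = mat_vec M N A \<sigma> i + (if i = r then t * \<sigma> j else 0)"
proof -
  have "(\<Sum>j'<N. (A((r, j) := A (r, j) + t)) (r, j') * \<sigma> j') = (\<Sum>j'<N. A (r, j') * \<sigma> j' + (if j' = j then t * \<sigma> j else 0))"
    by (intro sum.cong) (auto simp: algebra_simps)
  then show ?thesis
    using assms by (auto simp: mat_vec_def sum.distrib)
qed

text \<open>
  Take a minimiser \<open>(\<sigma>, y, z)\<close> up to \<open>\<eta>\<close>, and let \<open>w = (A \<sigma> - y - z) / \<epsilon>\<close>. Keeping the minimiser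
  while \<open>A\<close> changes shows that the rank-one matrix \<open>w \<sigma>\<^sup>T\<close> is a supergradient. Keeping \<open>A\<close> while \<open>z\<close>
  moves to \<open>z + \<tau> \<xi>\<close>, where near-optimality forbids a decrease by more than \<open>\<eta>\<close>, shows that \<open>w\<close> almost
  lies in the unit ball of the dual norm; the step \<open>\<tau> = sqrt \<eta>\<close> balances the two error terms.
\<close>

lemma smooth_margin_supergradient:
  assumes \<epsilon>: "\<epsilon> > 0" and \<eta>: "\<eta> > 0"
  obtains \<sigma> w where "\<sigma> \<in> Q"
    "\<And>r j t. r < M \<Longrightarrow> j < N \<Longrightarrow> smooth_margin \<epsilon> (A((r, j) := A (r, j) + t))
       \<le> smooth_margin \<epsilon> A + (\<bar>t\<bar> * \<bar>w r\<bar> * \<bar>\<sigma> j\<bar> + t\<^sup>2 / (2 * \<epsilon>) + \<eta>)"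
    "\<And>\<xi>. (\<Sum>i<M. w i * \<xi> i) \<le> \<nu> \<xi> + sqrt \<eta> * (1 + (\<Sum>i<M. (\<xi> i)\<^sup>2) / (2 * \<epsilon>))"
proof -
  obtain \<sigma> y z where *: "\<sigma> \<in> Q" "y \<in> E" and near: "penalty \<epsilon> A \<sigma> y z < smooth_margin \<epsilon> A + \<eta>"
    by (rule smooth_margin_near[OF \<eta>])
  define u where "u i = mat_vec M N A \<sigma> i - y i - z i" for i
  define w where "w i = u i / \<epsilon>" for i
  have pen: "penalty \<epsilon> A \<sigma> y z = \<nu> z + (\<Sum>i<M. (u i)\<^sup>2) / (2 * \<epsilon>)"
    by (simp add: penalty_def u_def)
  show thesis
  proof
    show "\<sigma> \<in> Q" by fact
  next
    fix r j t assume rj: "r < M" "j < N"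
    let ?A = "A((r, j) := A (r, j) + t)"
    have "(\<Sum>i<M. (mat_vec M N ?A \<sigma> i - y i - z i)\<^sup>2)
      = (\<Sum>i<M. (u i)\<^sup>2 + (if i = r then 2 * u r * (t * \<sigma> j) + (t * \<sigma> j)\<^sup>2 else 0))"
      unfolding mat_vec_update[OF rj] by (intro sum.cong) (auto simp: u_def power2_eq_square algebra_simps)
    also have "\<dots> = (\<Sum>i<M. (u i)\<^sup>2) + (2 * u r * (t * \<sigma> j) + (t * \<sigma> j)\<^sup>2)"
      using rj by (simp add: sum.distrib)
    finally have "penalty \<epsilon> ?A \<sigma> y z = penalty \<epsilon> A \<sigma> y z + (2 * u r * (t * \<sigma> j) + (t * \<sigma> j)\<^sup>2) / (2 * \<epsilon>)"
      unfolding pen by (simp add: penalty_def add_divide_distrib)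
    also have "(2 * u r * (t * \<sigma> j) + (t * \<sigma> j)\<^sup>2) / (2 * \<epsilon>) = t * w r * \<sigma> j + (t * \<sigma> j)\<^sup>2 / (2 * \<epsilon>)"
      using \<epsilon> by (simp add: w_def field_simps)
    also have "\<dots> \<le> \<bar>t\<bar> * \<bar>w r\<bar> * \<bar>\<sigma> j\<bar> + t\<^sup>2 / (2 * \<epsilon>)"
    proof (intro add_mono divide_right_mono)
      show "t * w r * \<sigma> j \<le> \<bar>t\<bar> * \<bar>w r\<bar> * \<bar>\<sigma> j\<bar>"
        using abs_ge_self[of "t * w r * \<sigma> j"] by (simp add: abs_mult)
      have "(\<sigma> j)\<^sup>2 \<le> 1" using Q_coordinate_le[OF *(1) rj(2)] by (simp add: abs_square_le_1)
      then show "(t * \<sigma> j)\<^sup>2 \<le> t\<^sup>2" by (simp add: power_mult_distrib mult_left_le)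
    qed (use \<epsilon> in simp)
    finally show "smooth_margin \<epsilon> ?A
       \<le> smooth_margin \<epsilon> A + (\<bar>t\<bar> * \<bar>w r\<bar> * \<bar>\<sigma> j\<bar> + t\<^sup>2 / (2 * \<epsilon>) + \<eta>)"
      using smooth_margin_le[OF \<epsilon> *, of ?A z] near by linarith
  next
    fix \<xi> :: "nat \<Rightarrow> real"
    define \<tau> where "\<tau> = sqrt \<eta>"
    have \<tau>: "\<tau> > 0" "\<tau>\<^sup>2 = \<eta>" using \<eta> by (auto simp: \<tau>_def)
    have "(\<Sum>i<M. (mat_vec M N A \<sigma> i - y i - (z i + \<tau> * \<xi> i))\<^sup>2)
      = (\<Sum>i<M. (u i)\<^sup>2 - 2 * \<epsilon> * \<tau> * (w i * \<xi> i) + \<tau>\<^sup>2 * (\<xi> i)\<^sup>2)"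
    proof (intro sum.cong refl)
      fix i
      have "mat_vec M N A \<sigma> i - y i - (z i + \<tau> * \<xi> i) = u i - \<tau> * \<xi> i"
        by (simp add: u_def)
      moreover have "u i = \<epsilon> * w i" using \<epsilon> by (simp add: w_def)
      ultimately show "(mat_vec M N A \<sigma> i - y i - (z i + \<tau> * \<xi> i))\<^sup>2
        = (u i)\<^sup>2 - 2 * \<epsilon> * \<tau> * (w i * \<xi> i) + \<tau>\<^sup>2 * (\<xi> i)\<^sup>2"
        by (simp add: power2_eq_square algebra_simps)
    qed
    also have "\<dots> = (\<Sum>i<M. (u i)\<^sup>2) - 2 * \<epsilon> * \<tau> * (\<Sum>i<M. w i * \<xi> i) + \<tau>\<^sup>2 * (\<Sum>i<M. (\<xi> i)\<^sup>2)"
      by (simp add: sum.distrib sum_subtractf sum_distrib_left)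
    finally have "penalty \<epsilon> A \<sigma> y (\<lambda>i. z i + \<tau> * \<xi> i) = \<nu> (\<lambda>i. z i + \<tau> * \<xi> i)
      + (\<Sum>i<M. (u i)\<^sup>2) / (2 * \<epsilon>) - \<tau> * (\<Sum>i<M. w i * \<xi> i) + \<tau>\<^sup>2 * ((\<Sum>i<M. (\<xi> i)\<^sup>2) / (2 * \<epsilon>))"
      using \<epsilon> by (simp add: penalty_def add_divide_distrib diff_divide_distrib)
    moreover have "\<nu> (\<lambda>i. z i + \<tau> * \<xi> i) \<le> \<nu> z + \<tau> * \<nu> \<xi>"
      using nu_triangle[of z "\<lambda>i. \<tau> * \<xi> i"] nu_scale[of \<tau> \<xi>] \<tau> by simp
    ultimately have "\<tau> * (\<Sum>i<M. w i * \<xi> i) \<le> \<tau> * \<nu> \<xi> + \<tau>\<^sup>2 * ((\<Sum>i<M. (\<xi> i)\<^sup>2) / (2 * \<epsilon>)) + \<eta>"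
      using smooth_margin_le[OF \<epsilon> *, of A "\<lambda>i. z i + \<tau> * \<xi> i"] near unfolding pen by linarith
    also have "\<dots> = \<tau> * (\<nu> \<xi> + \<tau> * (1 + (\<Sum>i<M. (\<xi> i)\<^sup>2) / (2 * \<epsilon>)))"
      unfolding \<tau>(2)[symmetric] by (simp add: power2_eq_square algebra_simps)
    finally show "(\<Sum>i<M. w i * \<xi> i) \<le> \<nu> \<xi> + sqrt \<eta> * (1 + (\<Sum>i<M. (\<xi> i)\<^sup>2) / (2 * \<epsilon>))"
      using \<tau> unfolding \<tau>_def[symmetric] by simp
  qed
qed

lemma smooth_margin_row_permute:
  assumes \<epsilon>: "\<epsilon> > 0" and \<pi>: "\<pi> permutes {..<M}" and inv: "\<And>i. \<pi> (\<pi> i) = i"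
    and nu_perm: "\<And>x. \<nu> (\<lambda>i. x (\<pi> i)) = \<nu> x"
    and E_perm: "\<And>y. y \<in> E \<Longrightarrow> (\<lambda>i. y (\<pi> i)) \<in> E"
  shows "smooth_margin \<epsilon> (\<lambda>(i, j). A (\<pi> i, j)) = smooth_margin \<epsilon> A"
proof -
  have le: "smooth_margin \<epsilon> (\<lambda>(i, j). A (\<pi> i, j)) \<le> smooth_margin \<epsilon> A" for A
  proof (rule smooth_margin_greatest)
    fix \<sigma> y z assume *: "\<sigma> \<in> Q" "y \<in> E"
    have mv: "mat_vec M N (\<lambda>(i, j). A (\<pi> i, j)) \<sigma> i = mat_vec M N A \<sigma> (\<pi> i)" for i
      using permutes_in_image[OF \<pi>, of i] by (simp add: mat_vec_def)
    have "penalty \<epsilon> (\<lambda>(i, j). A (\<pi> i, j)) \<sigma> (\<lambda>i. y (\<pi> i)) (\<lambda>i. z (\<pi> i)) = penalty \<epsilon> A \<sigma> y z"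
      using sum.permute[OF \<pi>, of "\<lambda>i. (mat_vec M N A \<sigma> i - y i - z i)\<^sup>2"]
      by (simp add: penalty_def nu_perm mv comp_def)
    then show "smooth_margin \<epsilon> (\<lambda>(i, j). A (\<pi> i, j)) \<le> penalty \<epsilon> A \<sigma> y z"
      using smooth_margin_le[OF \<epsilon> *(1) E_perm[OF *(2)], of "\<lambda>(i, j). A (\<pi> i, j)" "\<lambda>i. z (\<pi> i)"] by simp
  qed
  have "smooth_margin \<epsilon> A \<le> smooth_margin \<epsilon> (\<lambda>(i, j). A (\<pi> i, j))"
    using le[of "\<lambda>(i, j). A (\<pi> i, j)"] by (simp add: inv)
  then show ?thesis using le by (intro antisym)
qed

end

section \<open>Increments along the edges of the cube\<close>

definition flip :: "'i \<Rightarrow> 'i set \<Rightarrow> 'i set" where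
  "flip i S = (if i \<in> S then S - {i} else insert i S)"

lemma flip_flip [simp]: "flip i (flip i S) = S"
  by (auto simp: flip_def)

lemma bij_betw_flip:
  assumes "i \<in> J"
  shows "bij_betw (flip i) (Pow J) (Pow J)"
  by (rule bij_betw_byWitness[where f' = "flip i"]) (use assms in \<open>auto simp: flip_def\<close>)

lemma abs_cube_deriv: "\<bar>cube_deriv i f S\<bar> = \<bar>f (flip i S) - f S\<bar> / 2"
  by (cases "i \<in> S") (auto simp: cube_deriv_def flip_def insert_absorb)

text \<open>
  A supergradient bounds increments from above only. This is enough: each edge of the cube is an
  increase when traversed from its lower end, and \<open>flip i\<close> preserves the uniform measure.
\<close>

lemma cube_deriv_avg_le:
  assumes "i \<in> J"
    and incr: "\<And>S. S \<subseteq> J \<Longrightarrow> f (flip i S) \<le> f S + p S" and p: "\<And>S. S \<subseteq> J \<Longrightarrow> 0 \<le> p S"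
  shows "cube_avg J (\<lambda>S. \<bar>cube_deriv i f S\<bar>) \<le> cube_avg J p"
    and "cube_avg J (\<lambda>S. (cube_deriv i f S)\<^sup>2) \<le> cube_avg J (\<lambda>S. (p S)\<^sup>2)"
proof -
  have flip_sub: "flip i S \<subseteq> J" if "S \<subseteq> J" for S
    using that assms(1) by (auto simp: flip_def)
  have bound: "\<bar>cube_deriv i f S\<bar> \<le> (p S + p (flip i S)) / 2" if "S \<subseteq> J" for S
    using incr[OF that] incr[OF flip_sub[OF that]] p[OF that] p[OF flip_sub[OF that]]
    by (simp add: abs_cube_deriv)
  have reflect: "cube_avg J (\<lambda>S. g (flip i S)) = cube_avg J g" for g
    by (rule cube_avg_reindex[OF bij_betw_flip[OF assms(1)]])
  have "cube_avg J (\<lambda>S. \<bar>cube_deriv i f S\<bar>) \<le> cube_avg J (\<lambda>S. (p S + p (flip i S)) / 2)"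
    by (intro cube_avg_mono bound)
  then show "cube_avg J (\<lambda>S. \<bar>cube_deriv i f S\<bar>) \<le> cube_avg J p"
    by (simp add: cube_avg_divide cube_avg_add reflect)
  have "cube_avg J (\<lambda>S. (cube_deriv i f S)\<^sup>2) \<le> cube_avg J (\<lambda>S. ((p S)\<^sup>2 + (p (flip i S))\<^sup>2) / 2)"
  proof (intro cube_avg_mono)
    fix S assume "S \<subseteq> J"
    then have "(cube_deriv i f S)\<^sup>2 \<le> ((p S + p (flip i S)) / 2)\<^sup>2"
      using bound[of S] abs_ge_zero order_trans by (metis abs_le_square_iff abs_of_nonneg)
    also have "\<dots> \<le> ((p S)\<^sup>2 + (p (flip i S))\<^sup>2) / 2"
      using sum_squares_bound[of "p S" "p (flip i S)"] by (simp add: power2_eq_square field_simps)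
    finally show "(cube_deriv i f S)\<^sup>2 \<le> ((p S)\<^sup>2 + (p (flip i S))\<^sup>2) / 2" .
  qed
  then show "cube_avg J (\<lambda>S. (cube_deriv i f S)\<^sup>2) \<le> cube_avg J (\<lambda>S. (p S)\<^sup>2)"
    using reflect[of "\<lambda>S. (p S)\<^sup>2"] by (simp add: cube_avg_divide cube_avg_add)
qed

lemma cube_deriv_symmetric:
  assumes \<theta>: "bij_betw \<theta> J J" "\<And>i. \<theta> (\<theta> i) = i" and sym: "\<And>S. S \<subseteq> J \<Longrightarrow> f (\<theta> ` S) = f S" and i: "i \<in> J"
  shows "cube_avg J (\<lambda>S. \<bar>cube_deriv (\<theta> i) f S\<bar>) = cube_avg J (\<lambda>S. \<bar>cube_deriv i f S\<bar>)"
proof -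
  have inj: "inj \<theta>" using \<theta>(2) by (metis injI)
  have "cube_avg J (\<lambda>S. \<bar>cube_deriv (\<theta> i) f S\<bar>) = cube_avg J (\<lambda>S. \<bar>cube_deriv (\<theta> i) f (\<theta> ` S)\<bar>)"
    by (rule cube_avg_reindex[symmetric, OF bij_betw_Pow[OF \<theta>(1)]])
  also have "\<dots> = cube_avg J (\<lambda>S. \<bar>cube_deriv i f S\<bar>)"
  proof (intro cube_avg_cong)
    fix S assume S: "S \<subseteq> J"
    have eqs: "insert (\<theta> i) (\<theta> ` S) = \<theta> ` insert i S" "\<theta> ` S - {\<theta> i} = \<theta> ` (S - {i})"
      using inj by (auto simp: image_set_diff)
    have "f (\<theta> ` insert i S) = f (insert i S)" "f (\<theta> ` (S - {i})) = f (S - {i})"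
      using S i by (auto simp del: image_insert intro!: sym)
    then show "\<bar>cube_deriv (\<theta> i) f (\<theta> ` S)\<bar> = \<bar>cube_deriv i f S\<bar>"
      unfolding cube_deriv_def eqs by simp
  qed
  finally show ?thesis .
qed

lemma walk_flip:
  assumes "l < n"
  obtains t where "t\<^sup>2 = 4 / real n" "walk n (flip (i, l) S) = (walk n S)(i := walk n S i + t)"
proof
  let ?t = "- 2 * cube_sign S (i, l) / sqrt (real n)"
  show "?t\<^sup>2 = 4 / real n" by (simp add: cube_sign_def power_divide)
  show "walk n (flip (i, l) S) = (walk n S)(i := walk n S i + ?t)"
  proof
    fix i'
    have "(\<Sum>l'<n. cube_sign (flip (i, l) S) (i', l'))
      = (\<Sum>l'<n. cube_sign S (i', l') + (if l' = l then if i' = i then - 2 * cube_sign S (i, l) else 0 else 0))"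
      by (intro sum.cong refl) (auto simp: flip_def cube_sign_def)
    also have "\<dots> = (\<Sum>l'<n. cube_sign S (i', l')) + (if i' = i then - 2 * cube_sign S (i, l) else 0)"
      using assms by (simp add: sum.distrib)
    finally show "walk n (flip (i, l) S) i' = ((walk n S)(i := walk n S i + ?t)) i'"
      by (simp add: walk_def add_divide_distrib diff_divide_distrib)
  qed
qed

lemma walk_row_permute:
  assumes "\<And>r. \<pi> (\<pi> r) = r"
  shows "walk n ((\<lambda>((r, j), l). ((\<pi> r, j), l)) ` S) = (\<lambda>(r, j). walk n S (\<pi> r, j))"
proof -
  have "((r, j), l) \<in> (\<lambda>((r, j), l). ((\<pi> r, j), l)) ` S \<longleftrightarrow> ((\<pi> r, j), l) \<in> S" for r j l
  proof
    assume "((\<pi> r, j), l) \<in> S"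
    then have "(\<lambda>((r, j), l). ((\<pi> r, j), l)) ((\<pi> r, j), l) \<in> (\<lambda>((r, j), l). ((\<pi> r, j), l)) ` S"
      by (rule imageI)
    then show "((r, j), l) \<in> (\<lambda>((r, j), l). ((\<pi> r, j), l)) ` S" by (simp add: assms)
  qed (auto simp: assms)
  then show ?thesis by (auto simp: walk_def cube_sign_def fun_eq_iff)
qed

section \<open>Energy and influences under row symmetry\<close>

text \<open>
  The blocks of rows form the partition \<open>\<B>\<close>, and \<open>p\<close> stands for \<open>1 / q\<close>. Transpositions generate the
  permutations of a block, so the invariance assumptions are stated for them alone.
\<close>

locale symmetric_margin = margin_problem M N \<nu> Q E
  for M N :: nat and \<nu> :: "(nat \<Rightarrow> real) \<Rightarrow> real" and Q E :: "(nat \<Rightarrow> real) set" +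
  fixes \<B> :: "nat set set" and p :: real and m k :: nat
  assumes partition: "partition_on {..<M} \<B>" and card_blocks: "card \<B> \<le> k" and k: "1 \<le> k"
    and m: "1 \<le> m" and block_size: "B \<in> \<B> \<Longrightarrow> m \<le> card B"
    and p: "0 \<le> p" "p \<le> 1 / 2"
    and nu_flat: "B \<in> \<B> \<Longrightarrow> (\<And>i. \<bar>x i\<bar> \<le> indicator B i) \<Longrightarrow> \<nu> x \<le> real (card B) powr p"
    and nu_swap: "B \<in> \<B> \<Longrightarrow> r \<in> B \<Longrightarrow> r' \<in> B \<Longrightarrow> \<nu> (\<lambda>i. x (Transposition.transpose r r' i)) = \<nu> x"
    and E_swap: "B \<in> \<B> \<Longrightarrow> r \<in> B \<Longrightarrow> r' \<in> B \<Longrightarrow> y \<in> E \<Longrightarrow> (\<lambda>i. y (Transposition.transpose r r' i)) \<in> E"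
begin

abbreviation entries :: "(nat \<times> nat) set" where
  "entries \<equiv> {..<M} \<times> {..<N}"

abbreviation bits :: "nat \<Rightarrow> ((nat \<times> nat) \<times> nat) set" where
  "bits n \<equiv> entries \<times> {..<n}"

text \<open>
  Up to a constant, the reciprocal of \<open>\<rho>\<close> bounds the sum of the squared influences, so that half the
  logarithm of \<open>\<rho>\<close> is what the cube inequality gains.
\<close>

definition \<rho> :: real where
  "\<rho> = real m powr (1 - 2 * p) / real k"

lemma rho_pos: "\<rho> > 0"
  using m k by (simp add: \<rho>_def)

lemma blocks: "finite \<B>" "B \<in> \<B> \<Longrightarrow> B \<subseteq> {..<M}" "B \<in> \<B> \<Longrightarrow> finite B"
  using partition finite_elements[of "{..<M}" \<B>] by (auto simp: partition_on_def intro: finite_subset)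

lemma sum_rows: "(\<Sum>r<M. g r) = (\<Sum>B\<in>\<B>. \<Sum>r\<in>B. g r)" for g :: "nat \<Rightarrow> real"
proof -
  have "(\<Sum>r\<in>\<Union>\<B>. g r) = (\<Sum>B\<in>\<B>. \<Sum>r\<in>B. g r)"
    using partition blocks by (subst sum.Union_disjoint) (auto simp: partition_on_def disjoint_def)
  then show ?thesis using partition by (simp add: partition_on_def)
qed

lemma sum_bits:
  "(\<Sum>i\<in>bits n. h i) = (\<Sum>r<M. \<Sum>j<N. \<Sum>l<n. h ((r, j), l))"
  by (simp only: sum.cartesian_product')

lemma sum_block_powers_le: "(\<Sum>B\<in>\<B>. real (card B) powr (2 * p - 1)) \<le> 1 / \<rho>"
proof -
  have "(\<Sum>B\<in>\<B>. real (card B) powr (2 * p - 1)) \<le> (\<Sum>B\<in>\<B>. real m powr (2 * p - 1))"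
    using p m block_size by (intro sum_mono powr_mono2') auto
  also have "\<dots> \<le> real k * real m powr (2 * p - 1)"
    using card_blocks by (simp add: mult_right_mono)
  also have "real m powr (2 * p - 1) = 1 / real m powr (1 - 2 * p)"
    using powr_minus_divide[of "real m" "1 - 2 * p"] by simp
  finally show ?thesis by (simp add: \<rho>_def)
qed

text \<open>
  The slack \<open>\<eta> = 1 / n\<close> is of the order of the quadratic error term for increments of the size of a step
  of the walk. Testing \<open>w\<close> against its own direction bounds its Euclidean norm, since \<open>\<nu>\<close> is at most the
  Euclidean norm; testing it against its signs on a block bounds its \<open>\<ell>\<^sup>1\<close> norm there. The lower bound
  on \<open>n\<close> makes the error terms at most one.
\<close>

lemma supergradient_bounds:
  assumes \<epsilon>: "\<epsilon> > 0" and n: "n > 0" and n_large: "1 + (real M + 1) / (2 * \<epsilon>) \<le> sqrt (real n)"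
  obtains \<sigma> w where "(\<Sum>j<N. (\<sigma> j)\<^sup>2) \<le> 1" "(\<Sum>i<M. (w i)\<^sup>2) \<le> 4"
    "\<And>B. B \<in> \<B> \<Longrightarrow> (\<Sum>i\<in>B. \<bar>w i\<bar>) \<le> 2 * real (card B) powr p"
    "\<And>r j t. r < M \<Longrightarrow> j < N \<Longrightarrow> t\<^sup>2 = 4 / real n \<Longrightarrow>
      smooth_margin \<epsilon> (A((r, j) := A (r, j) + t))
        \<le> smooth_margin \<epsilon> A + (2 / sqrt (real n) * \<bar>w r\<bar> * \<bar>\<sigma> j\<bar> + (2 / \<epsilon> + 1) / real n)"
proof -
  define \<tau> where "\<tau> = 1 / sqrt (real n)"
  have \<tau>: "\<tau> > 0" "sqrt (1 / real n) = \<tau>" using n by (auto simp: \<tau>_def real_sqrt_divide)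
  have \<tau>_small: "\<tau> * (1 + c / (2 * \<epsilon>)) \<le> 1" if "c \<le> real M + 1" for c
  proof -
    have "1 + c / (2 * \<epsilon>) \<le> 1 + (real M + 1) / (2 * \<epsilon>)"
      using that \<epsilon> by (simp add: divide_right_mono)
    then have "1 + c / (2 * \<epsilon>) \<le> sqrt (real n)" using n_large by linarith
    then show ?thesis using n by (simp add: \<tau>_def)
  qed
  obtain \<sigma> w where \<sigma>: "\<sigma> \<in> Q"
    and incr: "\<And>r j t. r < M \<Longrightarrow> j < N \<Longrightarrow> smooth_margin \<epsilon> (A((r, j) := A (r, j) + t))
       \<le> smooth_margin \<epsilon> A + (\<bar>t\<bar> * \<bar>w r\<bar> * \<bar>\<sigma> j\<bar> + t\<^sup>2 / (2 * \<epsilon>) + 1 / real n)"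
    and dual: "\<And>\<xi>. (\<Sum>i<M. w i * \<xi> i) \<le> \<nu> \<xi> + \<tau> * (1 + (\<Sum>i<M. (\<xi> i)\<^sup>2) / (2 * \<epsilon>))"
    using smooth_margin_supergradient[OF \<epsilon>, of "1 / real n" A] n unfolding \<tau>(2) by auto
  show thesis
  proof
    show "(\<Sum>j<N. (\<sigma> j)\<^sup>2) \<le> 1" by (rule Q_sum_squares_le[OF \<sigma>])
  next
    define L where "L = L2_set w {..<M}"
    have L: "L \<ge> 0" "L\<^sup>2 = (\<Sum>i<M. (w i)\<^sup>2)" by (auto simp: L_def L2_set_def sum_nonneg)
    have "L \<le> 2"
    proof (cases "L = 0")
      case False
      then have "L > 0" using L by simp
      define \<xi> where "\<xi> i = w i / L" for i
      have sq: "(\<Sum>i<M. (\<xi> i)\<^sup>2) = 1"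
        using \<open>L > 0\<close> by (simp add: \<xi>_def power_divide sum_divide_distrib[symmetric] L(2)[symmetric])
      have "(\<Sum>i<M. w i * \<xi> i) = (\<Sum>i<M. (w i)\<^sup>2) / L"
        by (simp add: \<xi>_def sum_divide_distrib power2_eq_square)
      also have "\<dots> = L"
        unfolding L(2)[symmetric] using \<open>L > 0\<close> by (simp add: power2_eq_square)
      finally have "(\<Sum>i<M. w i * \<xi> i) = L" .
      moreover have "\<nu> \<xi> \<le> 1" using nu_le_L2[of \<xi>] by (simp add: L2_set_def sq)
      moreover have "\<tau> * (1 + 1 / (2 * \<epsilon>)) \<le> 1" by (rule \<tau>_small) simp
      ultimately show ?thesis using dual[of \<xi>] unfolding sq by linarith
    qed simp
    then have "L\<^sup>2 \<le> 2\<^sup>2" using L by (intro power_mono)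
    then show "(\<Sum>i<M. (w i)\<^sup>2) \<le> 4" using L by simp
  next
    fix B assume B: "B \<in> \<B>"
    define \<xi> where "\<xi> i = indicator B i * sgn (w i)" for i
    have "(\<Sum>i<M. w i * \<xi> i) = (\<Sum>i\<in>B. \<bar>w i\<bar>)"
      using blocks(2)[OF B] by (intro sum.mono_neutral_cong_right) (auto simp: \<xi>_def abs_sgn mult.commute)
    moreover have "\<nu> \<xi> \<le> real (card B) powr p"
      by (rule nu_flat[OF B]) (auto simp: \<xi>_def indicator_def abs_sgn_eq)
    moreover have "\<tau> * (1 + (\<Sum>i<M. (\<xi> i)\<^sup>2) / (2 * \<epsilon>)) \<le> 1"
    proof (rule \<tau>_small)
      have "(\<Sum>i<M. (\<xi> i)\<^sup>2) \<le> (\<Sum>i<M. 1)"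
        by (intro sum_mono) (auto simp: \<xi>_def indicator_def sgn_if)
      then show "(\<Sum>i<M. (\<xi> i)\<^sup>2) \<le> real M + 1" by simp
    qed
    moreover have "1 \<le> real (card B) powr p"
      using block_size[OF B] m p by (intro ge_one_powr_ge_zero) auto
    ultimately show "(\<Sum>i\<in>B. \<bar>w i\<bar>) \<le> 2 * real (card B) powr p"
      using dual[of \<xi>] by linarith
  next
    fix r j t assume rj: "r < M" "j < N" and t: "t\<^sup>2 = 4 / real n"
    have "\<bar>t\<bar> = sqrt (4 / real n)" unfolding t[symmetric] by simp
    then have "\<bar>t\<bar> = 2 / sqrt (real n)" by (simp add: real_sqrt_divide)
    moreover have "t\<^sup>2 / (2 * \<epsilon>) + 1 / real n = (2 / \<epsilon> + 1) / real n"
      using n \<epsilon> by (simp add: t field_simps)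
    ultimately show "smooth_margin \<epsilon> (A((r, j) := A (r, j) + t))
        \<le> smooth_margin \<epsilon> A + (2 / sqrt (real n) * \<bar>w r\<bar> * \<bar>\<sigma> j\<bar> + (2 / \<epsilon> + 1) / real n)"
      using incr[OF rj, of t] by (simp only: add.assoc)
  qed
qed

text \<open>
  Exchanging two rows of a block changes neither the smoothed margin nor the uniform measure on the cube.
\<close>

lemma cube_influence_row_symmetric:
  assumes \<epsilon>: "\<epsilon> > 0" and B: "B \<in> \<B>" "r \<in> B" "r' \<in> B" and jl: "j < N" "l < n"
  shows "cube_avg (bits n) (\<lambda>S. \<bar>cube_deriv ((r', j), l) (\<lambda>S. smooth_margin \<epsilon> (walk n S)) S\<bar>)
    = cube_avg (bits n) (\<lambda>S. \<bar>cube_deriv ((r, j), l) (\<lambda>S. smooth_margin \<epsilon> (walk n S)) S\<bar>)"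
proof -
  define \<pi> where "\<pi> = Transposition.transpose r r'"
  define \<theta> where "\<theta> = (\<lambda>((i, j), l). ((\<pi> i, j), l :: nat) :: (nat \<times> nat) \<times> nat)"
  have rr: "r < M" "r' < M" using blocks(2)[OF B(1)] B by auto
  have \<pi>: "\<pi> permutes {..<M}" unfolding \<pi>_def using rr by (intro permutes_swap_id) auto
  have inv: "\<pi> (\<pi> i) = i" for i by (simp add: \<pi>_def)
  have \<theta>\<theta>: "\<theta> (\<theta> x) = x" for x by (cases x) (auto simp: \<theta>_def inv)
  have "\<pi> i < M \<longleftrightarrow> i < M" for i using permutes_in_image[OF \<pi>, of i] by simp
  then have "\<theta> ` bits n \<subseteq> bits n" by (auto simp: \<theta>_def)
  then have bij: "bij_betw \<theta> (bits n) (bits n)"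
    by (intro bij_betw_byWitness[where f' = \<theta>]) (auto simp: \<theta>\<theta>)
  have sym: "smooth_margin \<epsilon> (walk n (\<theta> ` S)) = smooth_margin \<epsilon> (walk n S)" for S
    unfolding \<theta>_def walk_row_permute[of \<pi>, OF inv]
    by (rule smooth_margin_row_permute[OF \<epsilon> \<pi> inv]) (auto simp: \<pi>_def nu_swap[OF B] E_swap[OF B])
  have "((r, j), l) \<in> bits n" using rr jl by simp
  from cube_deriv_symmetric[of \<theta> "bits n" "\<lambda>S. smooth_margin \<epsilon> (walk n S)", OF bij \<theta>\<theta> sym this]
  show ?thesis by (simp add: \<theta>_def \<pi>_def)
qed

text \<open>
  Flipping the sign \<open>((r, j), l)\<close> raises the smoothed margin by at most a quantity of order
  \<open>\<bar>w\<^sub>r\<bar> \<bar>\<sigma>\<^sub>j\<bar> / sqrt n\<close>. Hence the energy is at most of order \<open>\<parallel>w\<parallel>\<^sup>2 \<parallel>\<sigma>\<parallel>\<^sup>2\<close>, which is bounded. By symmetry the influence of a row in a block of size \<open>b\<close> is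
  the average over the block, so it is governed by the \<open>\<ell>\<^sup>1\<close> norm of \<open>w\<close> on the block, at most \<open>2 b\<^sup>p\<close>,
  divided by \<open>b\<close>. Summing the squares over the \<open>b\<close> rows of each block gives \<open>b\<^sup>2\<^sup>p\<^sup>-\<^sup>1\<close> per block up to a
  constant, and at most a multiple of \<open>1 / \<rho>\<close> in total. The cube inequality with parameter
  \<open>s = sqrt (max \<rho> 1)\<close> then yields the claim: \<open>ln s\<close> is the gain, and \<open>s\<close> times the squared influences
  stays bounded.
\<close>

lemma cube_variance_smooth_margin:
  assumes \<epsilon>: "\<epsilon> > 0" and n: "n > 0" and n_large: "1 + (real M + 1) / (2 * \<epsilon>) \<le> sqrt (real n)"
    and n_large': "2 * (2 / \<epsilon> + 1)\<^sup>2 * real M * real N * max \<rho> 1 \<le> real n"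
  shows "cube_variance (bits n) (\<lambda>S. smooth_margin \<epsilon> (walk n S)) * (1 + 1 / 2 * ln (max \<rho> 1)) \<le> 165"
proof -
  define f where "f S = smooth_margin \<epsilon> (walk n S)" for S :: "((nat \<times> nat) \<times> nat) set"
  define K where "K = 2 / \<epsilon> + 1"
  define \<tau> where "\<tau> = 1 / sqrt (real n)"
  let ?J = "bits n"
  have fin: "finite ?J" by simp
  have \<tau>: "\<tau> > 0" "\<tau>\<^sup>2 = 1 / real n" using n by (auto simp: \<tau>_def power_divide)
  have n\<tau>: "real n * \<tau>\<^sup>2 = 1" using n by (simp add: \<tau>)
  have K: "K > 0" using \<epsilon> by (simp add: K_def add_pos_pos)
  have err: "2 * K\<^sup>2 * real M * real N * \<tau>\<^sup>2 \<le> 1 / max \<rho> 1"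
    using n_large'[folded K_def] n by (simp add: \<tau> field_simps)
  have err1: "2 * K\<^sup>2 * real M * real N * \<tau>\<^sup>2 \<le> 1"
    by (rule order_trans[OF err]) simp
  have err2: "2 * K\<^sup>2 * real M * real N * \<tau>\<^sup>2 \<le> 1 / \<rho>"
    using rho_pos by (intro order_trans[OF err] divide_left_mono) auto

  \<comment> \<open>The terms \<open>K * \<tau>\<^sup>2\<close> are errors: the sum of their squares over all signs vanishes as \<open>n\<close> grows, and the
      second lower bound on \<open>n\<close> makes it small enough.\<close>
  have scale: "(2 / \<epsilon> + 1) / real n = K * \<tau>\<^sup>2" "2 / sqrt (real n) = 2 * \<tau>"
    by (simp_all add: K_def \<tau>(2), simp add: \<tau>_def)
  have "\<exists>\<sigma> w. (\<Sum>j<N. (\<sigma> j)\<^sup>2) \<le> 1 \<and> (\<Sum>i<M. (w i)\<^sup>2) \<le> 4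
    \<and> (\<forall>B\<in>\<B>. (\<Sum>i\<in>B. \<bar>w i\<bar>) \<le> 2 * real (card B) powr p)
    \<and> (\<forall>r<M. \<forall>j<N. \<forall>t. t\<^sup>2 = 4 / real n \<longrightarrow>
      smooth_margin \<epsilon> ((walk n S)((r, j) := walk n S (r, j) + t))
        \<le> f S + (2 * \<tau> * \<bar>w r\<bar> * \<bar>\<sigma> j\<bar> + K * \<tau>\<^sup>2))" for S
    by (rule supergradient_bounds[OF \<epsilon> n n_large, of "walk n S", unfolded scale]) (unfold f_def, blast)
  then obtain \<sigma> w where \<sigma>: "\<And>S. (\<Sum>j<N. (\<sigma> S j)\<^sup>2) \<le> 1" and w2: "\<And>S. (\<Sum>i<M. (w S i)\<^sup>2) \<le> 4"
    and w1: "\<And>S B. B \<in> \<B> \<Longrightarrow> (\<Sum>i\<in>B. \<bar>w S i\<bar>) \<le> 2 * real (card B) powr p"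
    and incr: "\<And>S r j t. r < M \<Longrightarrow> j < N \<Longrightarrow> t\<^sup>2 = 4 / real n \<Longrightarrow>
      smooth_margin \<epsilon> ((walk n S)((r, j) := walk n S (r, j) + t))
        \<le> f S + (2 * \<tau> * \<bar>w S r\<bar> * \<bar>\<sigma> S j\<bar> + K * \<tau>\<^sup>2)"
    by metis

  define P where "P r j S = 2 * \<tau> * \<bar>w S r\<bar> * \<bar>\<sigma> S j\<bar> + K * \<tau>\<^sup>2" for r j S
  have P0: "0 \<le> P r j S" for r j S using \<tau> K by (simp add: P_def)
  have flip_le: "f (flip ((r, j), l) S) \<le> f S + P r j S" if "r < M" "j < N" "l < n" for r j l S
    using walk_flip[OF that(3), of "(r, j)" S] incr[OF that(1,2), of _ S] unfolding f_def P_def by metis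
  define I where "I r j l = cube_avg ?J (\<lambda>S. \<bar>cube_deriv ((r, j), l) f S\<bar>)" for r j l
  have I_le: "I r j l \<le> cube_avg ?J (P r j)"
    and I2_le: "cube_avg ?J (\<lambda>S. (cube_deriv ((r, j), l) f S)\<^sup>2) \<le> cube_avg ?J (\<lambda>S. (P r j S)\<^sup>2)"
    if "r < M" "j < N" "l < n" for r j l
    unfolding I_def using that by (auto intro!: cube_deriv_avg_le flip_le P0)

  have energy: "cube_energy ?J f \<le> 33"
  proof -
    have "cube_energy ?J f \<le> (\<Sum>r<M. \<Sum>j<N. \<Sum>l<n. cube_avg ?J (\<lambda>S. (P r j S)\<^sup>2))"
      unfolding cube_energy_def sum_bits by (intro sum_mono I2_le) auto
    also have "\<dots> = cube_avg ?J (\<lambda>S. \<Sum>r<M. \<Sum>j<N. real n * (P r j S)\<^sup>2)"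
      by (simp add: cube_avg_sum cube_avg_cmult)
    also have "\<dots> \<le> cube_avg ?J (\<lambda>S. 33)"
    proof (intro cube_avg_mono)
      fix S
      have "real n * (P r j S)\<^sup>2 \<le> 8 * (w S r)\<^sup>2 * (\<sigma> S j)\<^sup>2 + 2 * K\<^sup>2 * \<tau>\<^sup>2" for r j
      proof -
        have "(P r j S)\<^sup>2 \<le> 2 * (2 * \<tau> * \<bar>w S r\<bar> * \<bar>\<sigma> S j\<bar>)\<^sup>2 + 2 * (K * \<tau>\<^sup>2)\<^sup>2"
          unfolding P_def using sum_squares_bound[of "2 * \<tau> * \<bar>w S r\<bar> * \<bar>\<sigma> S j\<bar>" "K * \<tau>\<^sup>2"]
          by (simp add: power2_sum)
        also have "\<dots> = \<tau>\<^sup>2 * (8 * (w S r)\<^sup>2 * (\<sigma> S j)\<^sup>2 + 2 * K\<^sup>2 * \<tau>\<^sup>2)"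
          by (simp add: power_mult_distrib algebra_simps power2_eq_square)
        finally have "real n * (P r j S)\<^sup>2 \<le> real n * (\<tau>\<^sup>2 * (8 * (w S r)\<^sup>2 * (\<sigma> S j)\<^sup>2 + 2 * K\<^sup>2 * \<tau>\<^sup>2))"
          by (intro mult_left_mono) auto
        then show ?thesis by (simp only: mult.assoc[symmetric, of "real n"] n\<tau> mult_1)
      qed
      then have "(\<Sum>r<M. \<Sum>j<N. real n * (P r j S)\<^sup>2) \<le> (\<Sum>r<M. \<Sum>j<N. 8 * (w S r)\<^sup>2 * (\<sigma> S j)\<^sup>2 + 2 * K\<^sup>2 * \<tau>\<^sup>2)"
        by (intro sum_mono)
      also have "\<dots> = 8 * (\<Sum>r<M. \<Sum>j<N. (w S r)\<^sup>2 * (\<sigma> S j)\<^sup>2) + 2 * K\<^sup>2 * real M * real N * \<tau>\<^sup>2"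
        by (simp add: sum.distrib sum_distrib_left mult.assoc mult.left_commute)
      also have "(\<Sum>r<M. \<Sum>j<N. (w S r)\<^sup>2 * (\<sigma> S j)\<^sup>2) = (\<Sum>r<M. (w S r)\<^sup>2) * (\<Sum>j<N. (\<sigma> S j)\<^sup>2)"
        by (rule sum_product[symmetric])
      also have "8 * ((\<Sum>r<M. (w S r)\<^sup>2) * (\<Sum>j<N. (\<sigma> S j)\<^sup>2)) + 2 * K\<^sup>2 * real M * real N * \<tau>\<^sup>2 \<le> 8 * (4 * 1) + 1"
        using w2[of S] \<sigma>[of S] err1 by (intro add_mono mult_mono) (auto intro!: sum_nonneg mult_nonneg_nonneg)
      finally show "(\<Sum>r<M. \<Sum>j<N. real n * (P r j S)\<^sup>2) \<le> 33" by simp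
    qed
    finally show ?thesis by simp
  qed

  define infl where "infl = (\<Sum>i\<in>?J. (cube_avg ?J (\<lambda>S. \<bar>cube_deriv i f S\<bar>))\<^sup>2)"
  have infl_le: "infl \<le> 33"
  proof -
    have "infl \<le> cube_energy ?J f"
      unfolding infl_def cube_energy_def
      using cube_avg_square_le[OF fin, of "\<lambda>S. \<bar>cube_deriv _ f S\<bar>"] by (intro sum_mono) simp
    then show ?thesis using energy by simp
  qed
  have infl_le_rho: "infl \<le> 33 / \<rho>"
  proof -
    define a where "a j = cube_avg ?J (\<lambda>S. \<bar>\<sigma> S j\<bar>)" for j
    have a0: "0 \<le> a j" for j by (auto simp: a_def intro: cube_avg_nonneg)
    have a: "(\<Sum>j<N. (a j)\<^sup>2) \<le> 1"
    proof -
      have "(\<Sum>j<N. (a j)\<^sup>2) \<le> (\<Sum>j<N. cube_avg ?J (\<lambda>S. (\<sigma> S j)\<^sup>2))"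
        unfolding a_def using cube_avg_square_le[OF fin, of "\<lambda>S. \<bar>\<sigma> S _\<bar>"] by (intro sum_mono) simp
      also have "\<dots> = cube_avg ?J (\<lambda>S. \<Sum>j<N. (\<sigma> S j)\<^sup>2)"
        by (simp add: cube_avg_sum)
      also have "\<dots> \<le> cube_avg ?J (\<lambda>S. 1)" by (intro cube_avg_mono \<sigma>)
      finally show ?thesis by simp
    qed
    have influence: "I r j l \<le> 4 * \<tau> * real (card B) powr (p - 1) * a j + K * \<tau>\<^sup>2"
      if B: "B \<in> \<B>" "r \<in> B" and jl: "j < N" "l < n" for B r j l
    proof -
      let ?b = "real (card B)"
      have b: "?b > 0" using block_size[OF B(1)] m by simp
      have "?b * I r j l = (\<Sum>r'\<in>B. I r' j l)"
      proof -
        have "I r' j l = I r j l" if "r' \<in> B" for r'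
          unfolding I_def f_def[abs_def] by (rule cube_influence_row_symmetric[OF \<epsilon> B that jl])
        then show ?thesis by simp
      qed
      also have "\<dots> \<le> (\<Sum>r'\<in>B. cube_avg ?J (P r' j))"
        using blocks(2)[OF B(1)] jl by (intro sum_mono I_le) auto
      also have "\<dots> = cube_avg ?J (\<lambda>S. (2 * \<tau> * \<bar>\<sigma> S j\<bar>) * (\<Sum>r'\<in>B. \<bar>w S r'\<bar>) + ?b * (K * \<tau>\<^sup>2))"
        unfolding cube_avg_sum[symmetric] P_def
        by (simp add: sum.distrib sum_distrib_left mult_ac)
      also have "\<dots> \<le> cube_avg ?J (\<lambda>S. (2 * \<tau> * \<bar>\<sigma> S j\<bar>) * (2 * ?b powr p) + ?b * (K * \<tau>\<^sup>2))"
        using \<tau> w1[OF B(1)] by (intro cube_avg_mono add_right_mono mult_left_mono) auto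
      also have "\<dots> = cube_avg ?J (\<lambda>S. (4 * \<tau> * ?b powr p) * \<bar>\<sigma> S j\<bar> + ?b * (K * \<tau>\<^sup>2))"
        by (simp add: mult_ac)
      also have "\<dots> = 4 * \<tau> * ?b powr p * a j + ?b * (K * \<tau>\<^sup>2)"
        unfolding cube_avg_add cube_avg_cmult by (simp add: a_def)
      also have "?b powr p = ?b * ?b powr (p - 1)"
        using b by (simp add: powr_mult_base)
      finally have "?b * I r j l \<le> ?b * (4 * \<tau> * ?b powr (p - 1) * a j + K * \<tau>\<^sup>2)"
        by (simp add: algebra_simps)
      then show ?thesis using b by simp
    qed
    have block: "(\<Sum>r\<in>B. \<Sum>j<N. \<Sum>l<n. (I r j l)\<^sup>2)
      \<le> 32 * real (card B) powr (2 * p - 1) + 2 * K\<^sup>2 * real N * \<tau>\<^sup>2 * real (card B)"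
      if B: "B \<in> \<B>" for B
    proof -
      let ?b = "real (card B)"
      have b: "?b > 0" using block_size[OF B] m by simp
      define c where "c = ?b powr (p - 1)"
      have c2: "?b * c\<^sup>2 = ?b powr (2 * p - 1)"
      proof -
        have "c\<^sup>2 = ?b powr (2 * p - 2)"
          unfolding c_def using b by (simp add: power2_eq_square flip: powr_add)
        moreover have "?b * ?b powr (2 * p - 2) = ?b powr (1 + (2 * p - 2))"
          using b by (simp add: powr_mult_base)
        moreover have "1 + (2 * p - 2) = 2 * p - 1" by simp
        ultimately show ?thesis by simp
      qed
      have "(I r j l)\<^sup>2 \<le> \<tau>\<^sup>2 * (32 * c\<^sup>2 * (a j)\<^sup>2 + 2 * K\<^sup>2 * \<tau>\<^sup>2)" if "r \<in> B" "j < N" "l < n" for r j l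
      proof -
        have "(I r j l)\<^sup>2 \<le> (4 * \<tau> * c * a j + K * \<tau>\<^sup>2)\<^sup>2"
          using influence[OF B that] unfolding c_def
          by (intro power_mono) (auto simp: I_def intro: cube_avg_nonneg)
        also have "\<dots> \<le> 2 * (4 * \<tau> * c * a j)\<^sup>2 + 2 * (K * \<tau>\<^sup>2)\<^sup>2"
          using sum_squares_bound[of "4 * \<tau> * c * a j" "K * \<tau>\<^sup>2"] by (simp add: power2_sum)
        also have "\<dots> = \<tau>\<^sup>2 * (32 * c\<^sup>2 * (a j)\<^sup>2 + 2 * K\<^sup>2 * \<tau>\<^sup>2)"
          by (simp add: power_mult_distrib algebra_simps power2_eq_square)
        finally show ?thesis .
      qed
      then have "(\<Sum>r\<in>B. \<Sum>j<N. \<Sum>l<n. (I r j l)\<^sup>2)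
        \<le> (\<Sum>r\<in>B. \<Sum>j<N. \<Sum>l<n. \<tau>\<^sup>2 * (32 * c\<^sup>2 * (a j)\<^sup>2 + 2 * K\<^sup>2 * \<tau>\<^sup>2))"
        by (intro sum_mono) auto
      also have "\<dots> = ?b * (\<Sum>j<N. (real n * \<tau>\<^sup>2) * (32 * c\<^sup>2 * (a j)\<^sup>2 + 2 * K\<^sup>2 * \<tau>\<^sup>2))"
        by (simp add: mult.assoc)
      also have "\<dots> = 32 * (?b * c\<^sup>2) * (\<Sum>j<N. (a j)\<^sup>2) + 2 * K\<^sup>2 * real N * \<tau>\<^sup>2 * ?b"
        unfolding n\<tau> by (simp add: sum.distrib sum_distrib_left algebra_simps)
      also have "\<dots> \<le> 32 * ?b powr (2 * p - 1) * 1 + 2 * K\<^sup>2 * real N * \<tau>\<^sup>2 * ?b"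
        unfolding c2 using a by (intro add_mono mult_left_mono) auto
      finally show ?thesis by simp
    qed
    have "infl = (\<Sum>B\<in>\<B>. \<Sum>r\<in>B. \<Sum>j<N. \<Sum>l<n. (I r j l)\<^sup>2)"
      unfolding infl_def I_def sum_bits sum_rows ..
    also have "\<dots> \<le> (\<Sum>B\<in>\<B>. 32 * real (card B) powr (2 * p - 1) + 2 * K\<^sup>2 * real N * \<tau>\<^sup>2 * real (card B))"
      by (intro sum_mono block)
    also have "\<dots> = 32 * (\<Sum>B\<in>\<B>. real (card B) powr (2 * p - 1)) + 2 * K\<^sup>2 * real N * \<tau>\<^sup>2 * (\<Sum>B\<in>\<B>. real (card B))"
      by (simp add: sum.distrib sum_distrib_left)
    also have "(\<Sum>B\<in>\<B>. real (card B)) = real M"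
      using sum_rows[of "\<lambda>_. 1"] by simp
    also have "32 * (\<Sum>B\<in>\<B>. real (card B) powr (2 * p - 1)) + 2 * K\<^sup>2 * real N * \<tau>\<^sup>2 * real M \<le> 32 * (1 / \<rho>) + 1 / \<rho>"
      using sum_block_powers_le err2 by (intro add_mono mult_left_mono) (auto simp: mult_ac)
    finally show ?thesis by simp
  qed

  define s where "s = sqrt (max \<rho> 1)"
  have s: "s > 0" by (simp add: s_def)
  have "s * infl \<le> 33"
  proof (cases "\<rho> \<ge> 1")
    case True
    have "s * infl \<le> s * (33 / \<rho>)" using s infl_le_rho by (intro mult_left_mono) auto
    also have "\<dots> = 33 * (sqrt \<rho> / \<rho>)" using True by (simp add: s_def)
    also have "sqrt \<rho> / \<rho> \<le> 1"
      using True real_sqrt_le_mono[of \<rho> "\<rho> * \<rho>"] by (simp add: mult_le_cancel_left1 divide_le_eq_1)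
    finally show ?thesis by simp
  next
    case False
    then show ?thesis using infl_le by (simp add: s_def)
  qed
  moreover have "cube_variance ?J f * (1 + ln s) \<le> 4 * cube_energy ?J f + s * infl"
    unfolding infl_def by (rule cube_variance_bound[OF fin s])
  moreover have "ln s = 1 / 2 * ln (max \<rho> 1)"
    by (simp add: s_def ln_sqrt)
  ultimately have "cube_variance ?J f * (1 + 1 / 2 * ln (max \<rho> 1)) \<le> 165"
    using energy by simp
  then show ?thesis unfolding f_def[abs_def] .
qed

lemma eventually_cube_variance_dist_margin:
  "\<forall>\<^sub>F n in sequentially. cube_variance (bits n) (\<lambda>S. dist_margin (walk n S))
     \<le> 331 * inverse (1 + 1 / 2 * ln (max \<rho> 1))"
proof -
  define D where "D = 1 + 1 / 2 * ln (max \<rho> 1)"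
  have D: "D \<ge> 1" by (simp add: D_def)
  \<comment> \<open>Smoothing moves the margin by at most \<open>\<epsilon> / 2\<close>, which costs \<open>\<epsilon>\<^sup>2 / 2 \<le> 1 / D\<close> in the variance.\<close>
  define \<epsilon> where "\<epsilon> = 1 / D"
  have \<epsilon>: "\<epsilon> > 0" using D by (simp add: \<epsilon>_def)
  have "\<forall>\<^sub>F n in sequentially. (1 + (real M + 1) / (2 * \<epsilon>))\<^sup>2 \<le> real n"
    "\<forall>\<^sub>F n in sequentially. 2 * (2 / \<epsilon> + 1)\<^sup>2 * real M * real N * max \<rho> 1 \<le> real n"
    using filterlim_real_sequentially unfolding filterlim_at_top by blast+
  with eventually_gt_at_top[of "0::nat"] show ?thesis
  proof eventually_elim
    case (elim n)
    have "1 + (real M + 1) / (2 * \<epsilon>) \<le> sqrt (real n)"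
      using elim(2) by (rule real_le_rsqrt)
    from cube_variance_smooth_margin[OF \<epsilon> elim(1) this elim(3)]
    have smooth: "cube_variance (bits n) (\<lambda>S. smooth_margin \<epsilon> (walk n S)) \<le> 165 / D"
      using D unfolding D_def[symmetric] by (simp add: pos_le_divide_eq)
    have "cube_variance (bits n) (\<lambda>S. dist_margin (walk n S))
      \<le> 2 * cube_variance (bits n) (\<lambda>S. smooth_margin \<epsilon> (walk n S)) + 2 * (\<epsilon> / 2)\<^sup>2"
    proof (rule cube_variance_le_approx)
      fix S :: "((nat \<times> nat) \<times> nat) set"
      show "\<bar>dist_margin (walk n S) - smooth_margin \<epsilon> (walk n S)\<bar> \<le> \<epsilon> / 2"
        using smooth_margin_le_dist_margin[OF \<epsilon>, of "walk n S"] dist_margin_le_smooth_margin[OF \<epsilon>, of "walk n S"]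
        by linarith
    qed simp
    also have "\<dots> \<le> 2 * (165 / D) + 1 / D"
    proof (intro add_mono mult_left_mono smooth)
      have "\<epsilon> * \<epsilon> \<le> \<epsilon> * 1" using D by (intro mult_left_mono) (auto simp: \<epsilon>_def)
      then show "2 * (\<epsilon> / 2)\<^sup>2 \<le> 1 / D" using \<epsilon> by (simp add: power2_eq_square \<epsilon>_def[symmetric])
    qed simp
    also have "\<dots> = 331 * inverse D" by (simp add: field_simps)
    finally show ?case by (simp add: D_def)
  qed
qed

end

section \<open>Products of permutation symmetric blocks\<close>

definition offset :: "(nat \<Rightarrow> nat) \<Rightarrow> nat \<Rightarrow> nat" where
  "offset Ms b = (\<Sum>l<b. Ms l)"

definition block_rows :: "(nat \<Rightarrow> nat) \<Rightarrow> nat \<Rightarrow> nat set" where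
  "block_rows Ms b = {offset Ms b..<offset Ms (Suc b)}"

lemma offset_Suc: "offset Ms (Suc b) = offset Ms b + Ms b"
  by (simp add: offset_def)

lemma offset_mono: "b \<le> c \<Longrightarrow> offset Ms b \<le> offset Ms c"
  unfolding offset_def by (intro sum_mono2) auto

lemma rows_unique: "i \<in> block_rows Ms b \<Longrightarrow> i \<in> block_rows Ms c \<Longrightarrow> b = c"
  using offset_mono[of "Suc b" c Ms] offset_mono[of "Suc c" b Ms]
  by (cases b c rule: linorder_cases) (auto simp: block_rows_def)

lemma UN_rows: "(\<Union>b<k. block_rows Ms b) = {..<offset Ms k}"
proof (induction k)
  case (Suc k)
  have "{..<offset Ms k} \<union> block_rows Ms k = {..<offset Ms (Suc k)}"
    using offset_mono[of k "Suc k" Ms] by (auto simp: block_rows_def)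
  then show ?case using Suc by (simp add: lessThan_Suc Un_commute)
qed (simp add: offset_def)

lemma rows_subset: "b < k \<Longrightarrow> block_rows Ms b \<subseteq> {..<offset Ms k}"
  using UN_rows[of Ms k] by auto

lemma card_rows: "card (block_rows Ms b) = Ms b"
  by (simp add: block_rows_def offset_Suc)

lemma partition_on_rows:
  assumes "\<And>b. b < k \<Longrightarrow> Ms b \<ge> 1"
  shows "partition_on {..<offset Ms k} (block_rows Ms ` {..<k})"
proof (rule partition_onI)
  show "\<Union> (block_rows Ms ` {..<k}) = {..<offset Ms k}" by (rule UN_rows)
  show "disjnt B C" if "B \<in> block_rows Ms ` {..<k}" "C \<in> block_rows Ms ` {..<k}" "B \<noteq> C" for B C
  proof -
    obtain b c where "B = block_rows Ms b" "C = block_rows Ms c"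
      using \<open>B \<in> _\<close> \<open>C \<in> _\<close> by blast
    moreover from this \<open>B \<noteq> C\<close> have "b \<noteq> c" by auto
    ultimately show ?thesis using rows_unique[of _ Ms b c] unfolding disjnt_def by auto
  qed
  show "{} \<notin> block_rows Ms ` {..<k}"
  proof
    assume "{} \<in> block_rows Ms ` {..<k}"
    then obtain b where "b < k" "block_rows Ms b = {}" by auto
    then show False using assms[of b] card_rows[of Ms b] by simp
  qed
qed

lemma Rn_iff: "x \<in> Rn n \<longleftrightarrow> (\<forall>i\<ge>n. x i = 0)"
  by (simp add: topspace_Euclidean_space)

lemma block_in_Rn: "block Ms b x \<in> Rn (Ms b)"
  by (simp add: Rn_iff block_def)

lemma block_product_iff:
  "x \<in> block_product k Ms E \<longleftrightarrow> (\<forall>i\<ge>offset Ms k. x i = 0) \<and> (\<forall>b<k. block Ms b x \<in> E b)"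
  by (simp add: block_product_def Rn_iff offset_def)

lemma block_apply: "block Ms b x j = (if j < Ms b then x (offset Ms b + j) else 0)"
  by (simp add: block_def offset_def)

lemma in_rows_offset: "j < Ms b \<Longrightarrow> offset Ms b + j \<in> block_rows Ms b"
  by (simp add: block_rows_def offset_Suc)

lemma block_product_nonempty:
  assumes "\<And>b. b < k \<Longrightarrow> E b \<noteq> {}" and "\<And>b. b < k \<Longrightarrow> E b \<subseteq> Rn (Ms b)"
  shows "block_product k Ms E \<noteq> {}"
proof -
  have "\<forall>b. \<exists>e. b < k \<longrightarrow> e \<in> E b" using assms(1) by blast
  then obtain e where e: "\<And>b. b < k \<Longrightarrow> e b \<in> E b" by metis
  define y where "y i = (\<Sum>b<k. if i \<in> block_rows Ms b then e b (i - offset Ms b) else 0)" for i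
  have "block Ms c y = e c" if c: "c < k" for c
  proof
    fix j
    show "block Ms c y j = e c j"
    proof (cases "j < Ms c")
      case True
      have "offset Ms c + j \<in> block_rows Ms b \<longleftrightarrow> b = c" for b
        using in_rows_offset[of j Ms c] True rows_unique by blast
      then have "y (offset Ms c + j) = (\<Sum>b<k. if b = c then e b (offset Ms c + j - offset Ms b) else 0)"
        by (simp add: y_def)
      also have "\<dots> = e c j" using c by (simp add: sum.delta)
      finally show ?thesis using True by (simp add: block_apply)
    next
      case False
      then show ?thesis using e[OF c] assms(2)[OF c] by (auto simp: block_apply Rn_iff subset_iff)
    qed
  qed
  moreover have "y i = 0" if "i \<ge> offset Ms k" for i
    unfolding y_def
  proof (intro sum.neutral ballI)
    fix b assume "b \<in> {..<k}"
    then have "i \<notin> block_rows Ms b" using rows_subset[of b k Ms] that by auto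
    then show "(if i \<in> block_rows Ms b then e b (i - offset Ms b) else 0) = 0" by simp
  qed
  ultimately have "y \<in> block_product k Ms E"
    using e by (simp add: block_product_iff)
  then show ?thesis by blast
qed

lemma block_product_transpose:
  assumes b: "b < k" and r: "r \<in> block_rows Ms b" "r' \<in> block_rows Ms b"
    and sym: "permutation_symmetric (Ms b) (E b)" and y: "y \<in> block_product k Ms E"
  shows "(\<lambda>i. y (Transposition.transpose r r' i)) \<in> block_product k Ms E"
proof -
  let ?T = "Transposition.transpose r r'"
  define s where "s = r - offset Ms b"
  define s' where "s' = r' - offset Ms b"
  have s: "s < Ms b" "s' < Ms b" "r = offset Ms b + s" "r' = offset Ms b + s'"
    using r by (auto simp: s_def s'_def block_rows_def offset_Suc)
  have "r < offset Ms k" "r' < offset Ms k" using rows_subset[OF b, of Ms] r by auto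
  then have zero: "y (?T i) = 0" if "i \<ge> offset Ms k" for i
    using that y by (auto simp: Transposition.transpose_def block_product_iff)
  have "block Ms c (\<lambda>i. y (?T i)) \<in> E c" if c: "c < k" for c
  proof (cases "c = b")
    case False
    have "?T (offset Ms c + j) = offset Ms c + j" if "j < Ms c" for j
      using in_rows_offset[of j Ms c] that rows_unique r False by (auto simp: Transposition.transpose_def)
    then have "block Ms c (\<lambda>i. y (?T i)) = block Ms c y"
      by (auto simp: block_apply fun_eq_iff)
    then show ?thesis using y c by (simp add: block_product_iff)
  next
    case True
    let ?T' = "Transposition.transpose s s'"
    have "block Ms b (\<lambda>i. y (?T i)) = (\<lambda>j. block Ms b y (?T' j))"
      using s(1,2) unfolding s(3,4) by (auto simp: block_apply fun_eq_iff Transposition.transpose_def)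
    moreover have "?T' permutes {..<Ms b}"
      using s by (intro permutes_swap_id) auto
    moreover have "block Ms b y \<in> E b" using y b by (simp add: block_product_iff)
    ultimately show ?thesis
      using sym block_in_Rn[of Ms b y] True unfolding permutation_symmetric_def by auto
  qed
  then show ?thesis using zero by (simp add: block_product_iff)
qed

section \<open>The variance of the margin\<close>

theorem theorem1p4:
  shows "\<exists>C::real. C > 0 \<and>
    (\<forall>(N::nat) (k::nat) (Ms::nat \<Rightarrow> nat) (M::nat) (m::nat)
      (Q::(nat \<Rightarrow> real) set) (E::nat \<Rightarrow> (nat \<Rightarrow> real) set) (q::ereal).
      N \<ge> 1 \<longrightarrow> k \<ge> 1 \<longrightarrow> (\<forall>i<k. Ms i \<ge> 1) \<longrightarrow>
      M = (\<Sum>i<k. Ms i) \<longrightarrow>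
      m = Min (Ms ` {..<k}) \<longrightarrow>
      Q \<noteq> {} \<longrightarrow> Q \<subseteq> {\<sigma> \<in> Rn N. L2_set \<sigma> {..<N} \<le> 1} \<longrightarrow>
      (\<forall>i<k. E i \<noteq> {} \<and> closedin (Euclidean_space (Ms i)) (E i) \<and>
              permutation_symmetric (Ms i) (E i)) \<longrightarrow>
      2 \<le> q \<longrightarrow>
      integrable (gaussian_matrix M N) (\<lambda>A. (margin q M N Q (block_product k Ms E) A)\<^sup>2) \<and>
      prob_space.variance (gaussian_matrix M N) (margin q M N Q (block_product k Ms E))
        \<le> C * inverse (1 + 1/2 * ln (max (real m powr (1 - real_of_ereal (2 / q)) / real k) 1)))"
proof (intro exI[of _ 331] conjI allI impI)
  show "(0::real) < 331" by simp
next
  fix N k M m :: nat and Ms :: "nat \<Rightarrow> nat" and Q :: "(nat \<Rightarrow> real) set"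
    and E :: "nat \<Rightarrow> (nat \<Rightarrow> real) set" and q :: ereal
  assume N: "1 \<le> N" and k: "1 \<le> k" and Ms: "\<forall>i<k. 1 \<le> Ms i" and M: "M = (\<Sum>i<k. Ms i)"
    and m: "m = Min (Ms ` {..<k})" and Q: "Q \<noteq> {}" "Q \<subseteq> {\<sigma> \<in> Rn N. L2_set \<sigma> {..<N} \<le> 1}"
    and E: "\<forall>i<k. E i \<noteq> {} \<and> closedin (Euclidean_space (Ms i)) (E i) \<and> permutation_symmetric (Ms i) (E i)"
    and q: "2 \<le> q"
  define p where "p = real_of_ereal (2 / q) / 2"
  have M_offset: "M = offset Ms k" by (simp add: M offset_def)
  have "Ms 0 \<le> M" unfolding M using k by (intro member_le_sum) auto
  then have M1: "1 \<le> M" using Ms k by force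
  have nonempty: "{..<k} \<noteq> {}" using k by (simp add: lessThan_empty_iff)
  have "m \<in> Ms ` {..<k}" unfolding m using nonempty by (intro Min_in) auto
  then have m1: "1 \<le> m" using Ms by auto
  interpret symmetric_margin M N "lq_norm q M" Q "block_product k Ms E" "block_rows Ms ` {..<k}" p m k
  proof
    show "0 \<le> lq_norm q M x" for x by (rule lq_norm_nonneg[OF M1])
    show "lq_norm q M (\<lambda>i. x i + y i) \<le> lq_norm q M x + lq_norm q M y" for x y
      by (rule lq_norm_triangle[OF q M1])
    show "lq_norm q M (\<lambda>i. c * x i) = c * lq_norm q M x" if "0 \<le> c" for c x
      by (rule lq_norm_scale[OF q M1 that])
    show "lq_norm q M x \<le> L2_set x {..<M}" for x by (rule lq_norm_le_L2[OF q M1])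
    show "Q \<noteq> {}" by fact
    show "L2_set \<sigma> {..<N} \<le> 1" if "\<sigma> \<in> Q" for \<sigma> using Q that by auto
    show "block_product k Ms E \<noteq> {}"
      using E by (intro block_product_nonempty) (auto dest: closedin_subset)
    show "partition_on {..<M} (block_rows Ms ` {..<k})"
      unfolding M_offset using Ms by (intro partition_on_rows) auto
    show "card (block_rows Ms ` {..<k}) \<le> k"
      using card_image_le[of "{..<k}" "block_rows Ms"] by simp
    show "1 \<le> k" "1 \<le> m" by fact+
    show "0 \<le> p" "p \<le> 1 / 2"
      using q unfolding p_def by (cases q; simp add: numeral_eq_ereal)+
    fix B assume "B \<in> block_rows Ms ` {..<k}"
    then obtain b where b: "b < k" "B = block_rows Ms b" by auto
    show "m \<le> card B" using b by (simp add: m card_rows)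
    have "card B \<ge> 1" using b Ms by (simp add: card_rows)
    then have "B \<subseteq> {..<M}" "B \<noteq> {}" unfolding M_offset using b rows_subset[of b k Ms] by auto
    then show "lq_norm q M x \<le> real (card B) powr p" if "\<And>i. \<bar>x i\<bar> \<le> indicator B i" for x
      unfolding p_def using that by (intro lq_norm_indicator_le[OF q M1])
    fix r r' assume r: "r \<in> B" "r' \<in> B"
    then have "Transposition.transpose r r' permutes {..<M}"
      using \<open>B \<subseteq> {..<M}\<close> by (intro permutes_swap_id) auto
    then show "lq_norm q M (\<lambda>i. x (Transposition.transpose r r' i)) = lq_norm q M x" for x
      by (rule lq_norm_permute)
    show "(\<lambda>i. y (Transposition.transpose r r' i)) \<in> block_product k Ms E" if "y \<in> block_product k Ms E" for y
      using block_product_transpose[OF b(1) _ _ _ that] r E b by auto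
  qed
  have margin: "margin q M N Q (block_product k Ms E) = dist_margin"
    by (simp add: fun_eq_iff margin_def lq_dist_def dist_margin_def)
  have gauss: "gaussian_matrix M N = PiM entries (\<lambda>_. std_normal_distribution)"
    by (simp add: gaussian_matrix_def)
  have rho: "real m powr (1 - real_of_ereal (2 / q)) / real k = \<rho>"
    unfolding \<rho>_def by (simp add: p_def)
  have "(0, 0) \<in> entries" using M1 N by auto
  then have ne: "entries \<noteq> {}" by blast
  have "0 \<le> 331 * inverse (1 + 1 / 2 * ln (max \<rho> 1))" by simp
  note bound = gaussian_variance_le_cube_variance[OF _ ne dist_margin_Lipschitz this eventually_cube_variance_dist_margin]
  show "integrable (gaussian_matrix M N) (\<lambda>A. (margin q M N Q (block_product k Ms E) A)\<^sup>2)"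
    unfolding margin gauss by (rule bound) simp
  show "prob_space.variance (gaussian_matrix M N) (margin q M N Q (block_product k Ms E))
    \<le> 331 * inverse (1 + 1 / 2 * ln (max (real m powr (1 - real_of_ereal (2 / q)) / real k) 1))"
    unfolding margin gauss rho by (rule bound) simp
qed

end
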